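(* We have the identity of formal power series in two sets of variables $x=(x_1,x_2,\dots)$ and $y=(y_1,y_2,\dots)$ $$\sum_{\lambda \in \mathcal{OP}} 2^{\ell(\lambda)} z_\lambda^{-1}\, p_\lambda^{(\beta)}(x)\, p_\lambda^{[\beta]}(y) = \prod_{i,j} \frac{1 - \overline{x_i}\, y_j}{1 - x_i y_j}.$$ In other words, the Cauchy kernel of the bilinear form $\langle\cdot,\cdot\rangle$ on $G\Gamma_\sharp\otimes_{\mathbb{Q}(\beta)} g\Gamma$ (the sum $\sum_\lambda u_\lambda(x)v_\lambda(y)$ for the dual families $u_\lambda=p_\lambda^{(\beta)}$, $v_\lambda=2^{\ell(\lambda)}z_\lambda^{-1}p_\lambda^{[\beta]}$, $\lambda\in\mathcal{OP}$) is $\prod_{i,j} \frac{1 - \overline{x_i} y_j}{1 - x_i y_j}$.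
   Context: $\beta$ is a formal parameter, coefficients are in $\mathbb{Q}(\beta)$, and $\overline{u} := \frac{-u}{1+\beta u}$ (expanded as a power series in $u$). $p_i(x)=\sum_j x_j^i$ are the power sums. Define $p_n^{(\beta)}(x) = p_n\big(\tfrac{x_1}{1+\frac{\beta}{2}x_1},\tfrac{x_2}{1+\frac{\beta}{2}x_2},\dots\big)=\sum_{k\ge0}\binom{-n}{k}(\tfrac{\beta}{2})^k p_{n+k}(x)$ and $p_n^{[\beta]}(x)=\sum_{k=0}^{n-1}\binom{n}{k}(\tfrac{\beta}{2})^k p_{n-k}(x)$. For a partition $\lambda$, $p_\lambda^{(\beta)}=\prod_i p_{\lambda_i}^{(\beta)}$ and $p_\lambda^{[\beta]}=\prod_i p_{\lambda_i}^{[\beta]}$ (products over the parts; $1$ for the empty partition), $\ell(\lambda)$ is the number of parts, and $z_\lambda=\prod_{i\ge1} i^{m_i}m_i!$ with $m_i=\#\{s\mid\lambda_s=i\}$. $\mathcal{OP}$ is the set of partitions all of whose parts are odd (including the empty partition). $\widehat{\Lambda}_\sharp$ is the $\mathbb{Q}(\beta)$-algebra of all formal infinite sums $\sum_{n}\sum_{|\lambda|=n} c_\lambda p_{\lambda_1}p_{\lambda_2}\cdots$, $c_\lambda\in\mathbb{Q}(\beta)$; $G\Gamma_\sharp$ is its subalgebra of $f$ with $f(t,\overline{t},x_3,x_4,\dots)$ independent of $t$; every element of $G\Gamma_\sharp$ is uniquely an infinite $\mathbb{Q}(\beta)$-linear combination of the $p_\lambda^{(\beta)}$, $\lambda\in\mathcal{OP}$.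 $\Lambda$ is the $\mathbb{Q}(\beta)$-algebra of symmetric functions; $g\Gamma\subset\Lambda$ is the subalgebra of $f$ with $f(t,-t-\beta,x_3,x_4,\dots)$ independent of $t$; it has $\mathbb{Q}(\beta)$-basis $p_\lambda^{[\beta]}$, $\lambda\in\mathcal{OP}$. The bilinear form $G\Gamma_\sharp\otimes_{\mathbb{Q}(\beta)} g\Gamma\to\mathbb{Q}(\beta)$ is defined by $\langle p_\lambda^{(\beta)},p_\mu^{[\beta]}\rangle=2^{-\ell(\lambda)}z_\lambda\delta_{\lambda,\mu}$ for $\lambda,\mu\in\mathcal{OP}$ (extended to infinite linear combinations in the first argument). *)

theory Defs
  imports
    "HOL-Analysis.Infinite_Sum"
    "HOL-Library.Multiset"
    "HOL-Computational_Algebra.Polynomial_Factorial"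
begin

section \<open>Formal power series in an arbitrary set of variables\<close>

text \<open>
  Monomials in variables \<open>'v\<close> are finite multisets over \<open>'v\<close> (the multiplicity of a variable is
  its exponent), and a formal power series is an arbitrary family of coefficients indexed by
  monomials. In particular \<open>'v\<close> may be infinite and the degree may be unbounded.
\<close>

typedef ('v, 'a) mps = "UNIV :: ('v multiset \<Rightarrow> 'a) set"
  morphisms mps_nth Abs_mps
  by simp

lemma mps_nth_Abs [simp]: "mps_nth (Abs_mps f) = f"
  by (simp add: Abs_mps_inverse)

lemma mps_eqI: "(\<And>m. mps_nth f m = mps_nth g m) \<Longrightarrow> f = g"
  by (metis mps_nth_inject ext)

lemma finite_submultisets: "finite {a. a \<subseteq># m}"
proof (induction m)
  case (add x m)
  have "{a. a \<subseteq># add_mset x m} \<subseteq> {a. a \<subseteq># m} \<union> add_mset x ` {a. a \<subseteq># m}"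
  proof
    fix a assume "a \<in> {a. a \<subseteq># add_mset x m}"
    then have a: "a \<subseteq># add_mset x m" by simp
    show "a \<in> {a. a \<subseteq># m} \<union> add_mset x ` {a. a \<subseteq># m}"
    proof (cases "x \<in># a")
      case True
      then obtain b where "a = add_mset x b" by (metis mset_add)
      with a show ?thesis by auto
    next
      case False
      with a have "a \<subseteq># m" by (metis diff_single_trivial subset_eq_diff_conv add_mset_add_single)
      then show ?thesis by simp
    qed
  qed
  with add.IH show ?case by (meson finite_UnI finite_imageI finite_subset)
qed simp

lemma double_diff_submultiset: "m - (m - a) = a" if "a \<subseteq># m" for a m :: "'v multiset"
  using that by (auto simp: multiset_eq_iff subseteq_mset_def)

instantiation mps :: (type, comm_ring_1) comm_ring_1
begin

definition zero_mps :: "('a, 'b) mps" where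
  "0 = Abs_mps (\<lambda>m. 0)"

definition one_mps :: "('a, 'b) mps" where
  "1 = Abs_mps (\<lambda>m. if m = {#} then 1 else 0)"

definition plus_mps :: "('a, 'b) mps \<Rightarrow> ('a, 'b) mps \<Rightarrow> ('a, 'b) mps" where
  "f + g = Abs_mps (\<lambda>m. mps_nth f m + mps_nth g m)"

definition minus_mps :: "('a, 'b) mps \<Rightarrow> ('a, 'b) mps \<Rightarrow> ('a, 'b) mps" where
  "f - g = Abs_mps (\<lambda>m. mps_nth f m - mps_nth g m)"

definition uminus_mps :: "('a, 'b) mps \<Rightarrow> ('a, 'b) mps" where
  "- f = Abs_mps (\<lambda>m. - mps_nth f m)"

definition times_mps :: "('a, 'b) mps \<Rightarrow> ('a, 'b) mps \<Rightarrow> ('a, 'b) mps" where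
  "f * g = Abs_mps (\<lambda>m. \<Sum>a | a \<subseteq># m. mps_nth f a * mps_nth g (m - a))"

instance
proof
  fix f g h :: "('a, 'b) mps"
  show "f * g * h = f * (g * h)"
  proof (rule mps_eqI)
    fix m
    have "mps_nth (f * g * h) m =
      (\<Sum>a | a \<subseteq># m. \<Sum>b | b \<subseteq># a. mps_nth f b * mps_nth g (a - b) * mps_nth h (m - a))"
      by (simp add: times_mps_def sum_distrib_right)
    also have "\<dots> = (\<Sum>(a, b)\<in>(SIGMA a:{a. a \<subseteq># m}. {b. b \<subseteq># a}).
        mps_nth f b * mps_nth g (a - b) * mps_nth h (m - a))"
      by (subst sum.Sigma) (auto simp: finite_submultisets)
    also have "\<dots> = (\<Sum>(b, c)\<in>(SIGMA b:{b. b \<subseteq># m}. {c. c \<subseteq># m - b}).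
        mps_nth f b * mps_nth g c * mps_nth h (m - b - c))"
      by (rule sum.reindex_bij_witness[of _ "\<lambda>(b, c). (b + c, b)" "\<lambda>(a, b). (b, a - b)"])
        (auto simp: subset_mset.le_diff_conv2 subset_mset.add_diff_inverse
          add.commute subset_mset.diff_add intro: subset_mset.order_trans)
    also have "\<dots> = (\<Sum>b | b \<subseteq># m. \<Sum>c | c \<subseteq># m - b.
        mps_nth f b * mps_nth g c * mps_nth h (m - b - c))"
      by (subst sum.Sigma) (auto simp: finite_submultisets)
    also have "\<dots> = mps_nth (f * (g * h)) m"
      by (simp add: times_mps_def sum_distrib_left mult.assoc)
    finally show "mps_nth (f * g * h) m = mps_nth (f * (g * h)) m" .
  qed
  show "f * g = g * f"
  proof (rule mps_eqI)
    fix m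
    show "mps_nth (f * g) m = mps_nth (g * f) m"
      unfolding times_mps_def mps_nth_Abs
      by (rule sum.reindex_bij_witness[of _ "\<lambda>a. m - a" "\<lambda>a. m - a"])
        (auto simp: mult.commute double_diff_submultiset)
  qed
  show "1 * f = f"
  proof (rule mps_eqI)
    fix m
    have "mps_nth (1 * f) m = (\<Sum>a | a \<subseteq># m. if a = {#} then mps_nth f m else 0)"
      by (auto simp: times_mps_def one_mps_def intro!: sum.cong)
    then show "mps_nth (1 * f) m = mps_nth f m"
      by (simp add: finite_submultisets)
  qed
  show "(f + g) * h = f * h + g * h"
    by (rule mps_eqI) (simp add: times_mps_def plus_mps_def distrib_right sum.distrib)
  show "(0 :: ('a, 'b) mps) \<noteq> 1"
  proof
    assume "(0 :: ('a, 'b) mps) = 1"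
    then have "mps_nth (0 :: ('a, 'b) mps) {#} = mps_nth 1 {#}" by simp
    then show False by (simp add: zero_mps_def one_mps_def)
  qed
qed (auto intro!: mps_eqI simp: zero_mps_def plus_mps_def minus_mps_def uminus_mps_def)

end

text \<open>An inverse, if it exists, is unique by commutativity. Quotients are only meaningful for denominators that are units, i.e. power series
  with invertible constant term, where they are the usual geometric series expansions.\<close>

instantiation mps :: (type, comm_ring_1) inverse
begin

definition inverse_mps where
  "inverse f = (if \<exists>g :: ('a, 'b) mps. f * g = 1 then THE g. f * g = 1 else 0)"

definition divide_mps where
  "f div g = f * inverse (g :: ('a, 'b) mps)"

instance ..

end

lemma mps_inverse_unique:
  fixes f g :: "('v, 'a::comm_ring_1) mps"
  assumes "f * g = 1"
  shows "inverse f = g"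
proof -
  have "h = g" if h: "f * h = 1" for h
  proof -
    have "h = h * (f * g)" using assms by simp
    also have "\<dots> = (f * h) * g" by (simp only: mult_ac)
    also have "\<dots> = g" using h by simp
    finally show ?thesis .
  qed
  then have "(THE h. f * h = 1) = g"
    by (intro the_equality assms)
  with assms show ?thesis
    unfolding inverse_mps_def by auto
qed

text \<open>The topology of coefficientwise stabilisation (the product of the discrete topologies), so
  that \<open>has_sum\<close> is the usual notion of an infinite sum of formal power series.\<close>

instantiation mps :: (type, type) t2_space
begin

definition open_mps :: "('a, 'b) mps set \<Rightarrow> bool" where
  "open U \<longleftrightarrow> (\<forall>f\<in>U. \<exists>M. finite M \<and> {g. \<forall>m\<in>M. mps_nth g m = mps_nth f m} \<subseteq> U)"

instance
proof
  show "open (UNIV :: ('a, 'b) mps set)"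
    by (auto simp: open_mps_def)
  fix S T :: "('a, 'b) mps set"
  assume S: "open S" and T: "open T"
  show "open (S \<inter> T)"
    unfolding open_mps_def
  proof
    fix f assume f: "f \<in> S \<inter> T"
    from f S obtain M where M: "finite M" "{g. \<forall>m\<in>M. mps_nth g m = mps_nth f m} \<subseteq> S"
      unfolding open_mps_def by blast
    from f T obtain N where N: "finite N" "{g. \<forall>m\<in>N. mps_nth g m = mps_nth f m} \<subseteq> T"
      unfolding open_mps_def by blast
    from M N show "\<exists>M. finite M \<and> {g. \<forall>m\<in>M. mps_nth g m = mps_nth f m} \<subseteq> S \<inter> T"
      by (intro exI[of _ "M \<union> N"]) auto
  qed
next
  fix K :: "('a, 'b) mps set set"
  assume K: "\<forall>S\<in>K. open S"
  show "open (\<Union>K)"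
    unfolding open_mps_def
  proof
    fix f assume "f \<in> \<Union>K"
    then obtain S where S: "S \<in> K" "f \<in> S" by blast
    with K have "open S" by blast
    then obtain M where "finite M" "{g. \<forall>m\<in>M. mps_nth g m = mps_nth f m} \<subseteq> S"
      using S unfolding open_mps_def by blast
    with S show "\<exists>M. finite M \<and> {g. \<forall>m\<in>M. mps_nth g m = mps_nth f m} \<subseteq> \<Union>K"
      by (intro exI[of _ M]) blast
  qed
next
  fix f g :: "('a, 'b) mps"
  assume "f \<noteq> g"
  then obtain m where m: "mps_nth f m \<noteq> mps_nth g m" by (metis mps_eqI)
  have "open {h :: ('a, 'b) mps. mps_nth h m = c}" for c
    unfolding open_mps_def by (auto intro!: exI[of _ "{m}"])
  with m show "\<exists>U V. open U \<and> open V \<and> f \<in> U \<and> g \<in> V \<and> U \<inter> V = {}"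
    by (intro exI[of _ "{h. mps_nth h m = mps_nth f m}"]
        exI[of _ "{h. mps_nth h m = mps_nth g m}"]) auto
qed

end

lemma tendsto_mps_iff:
  "(F \<longlongrightarrow> L) net \<longleftrightarrow> (\<forall>m. eventually (\<lambda>x. mps_nth (F x) m = mps_nth L m) net)"
  for F :: "'c \<Rightarrow> ('v, 'a) mps"
proof
  assume F: "(F \<longlongrightarrow> L) net"
  show "\<forall>m. eventually (\<lambda>x. mps_nth (F x) m = mps_nth L m) net"
  proof
    fix m
    have "open {h :: ('v, 'a) mps. mps_nth h m = mps_nth L m}"
      unfolding open_mps_def by (auto intro!: exI[of _ "{m}"])
    from topological_tendstoD[OF F this]
    show "eventually (\<lambda>x. mps_nth (F x) m = mps_nth L m) net"
      by simp
  qed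
next
  assume ev: "\<forall>m. eventually (\<lambda>x. mps_nth (F x) m = mps_nth L m) net"
  show "(F \<longlongrightarrow> L) net"
  proof (rule topological_tendstoI)
    fix S :: "('v, 'a) mps set"
    assume "open S" "L \<in> S"
    then obtain M where M: "finite M" "{g. \<forall>m\<in>M. mps_nth g m = mps_nth L m} \<subseteq> S"
      unfolding open_mps_def by blast
    from M(1) ev have "eventually (\<lambda>x. \<forall>m\<in>M. mps_nth (F x) m = mps_nth L m) net"
      by (simp add: eventually_ball_finite)
    then show "eventually (\<lambda>x. F x \<in> S) net"
      by (rule eventually_mono) (use M(2) in blast)
  qed
qed

text \<open>Unordered infinite products, the multiplicative counterpart of \<open>has_sum\<close>.\<close>

definition has_uprod ::
    "('i \<Rightarrow> 'b::{comm_monoid_mult, topological_space}) \<Rightarrow> 'b \<Rightarrow> 'i set \<Rightarrow> bool" where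
  "has_uprod f P A \<longleftrightarrow> (prod f \<longlongrightarrow> P) (finite_subsets_at_top A)"

definition mps_const :: "'a::comm_ring_1 \<Rightarrow> ('v, 'a) mps" where
  "mps_const c = Abs_mps (\<lambda>m. if m = {#} then c else 0)"

definition mps_var :: "'v \<Rightarrow> ('v, 'a::comm_ring_1) mps" where
  "mps_var i = Abs_mps (\<lambda>m. if m = {#i#} then 1 else 0)"

text \<open>Substitution \<open>f(z\<^sub>1, z\<^sub>2, \<dots>)\<close>; only meaningful when the sum converges.\<close>

definition mps_subst ::
    "('v \<Rightarrow> ('w, 'a::comm_ring_1) mps) \<Rightarrow> ('v, 'a) mps \<Rightarrow> ('w, 'a) mps" where
  "mps_subst z f = (\<Sum>\<^sub>\<infinity>m. mps_const (mps_nth f m) * (\<Prod>i\<in>#m. z i))"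

definition mps_indep :: "'v \<Rightarrow> ('v, 'a::zero) mps \<Rightarrow> bool" where
  "mps_indep i f \<longleftrightarrow> (\<forall>m. i \<in># m \<longrightarrow> mps_nth f m = 0)"


section \<open>Partitions\<close>

text \<open>A partition is the multiset of its parts, so its length is its \<^const>\<open>size\<close> and the
  multiplicities \<open>m\<^sub>i\<close> are its \<^const>\<open>count\<close>. Odd parts are automatically positive.\<close>

definition Partitions :: "nat multiset set" where
  "Partitions = {\<mu>. 0 \<notin># \<mu>}"

definition OP :: "nat multiset set" where
  "OP = {\<mu>. \<forall>i\<in>#\<mu>. odd i}"

definition z_part :: "nat multiset \<Rightarrow> nat" where
  "z_part \<mu> = (\<Prod>i\<in>set_mset \<mu>. i ^ count \<mu> i * fact (count \<mu> i))"


section \<open>Power sums and their deformations over the field of rational functions in \<open>\<beta>\<close>\<close>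

type_synonym qbeta = "rat poly fract"

definition beta :: qbeta where
  "beta = to_fract [:0, 1:]"

definition bar :: "('v, qbeta) mps \<Rightarrow> ('v, qbeta) mps" where
  "bar u = (- u) / (1 + mps_const beta * u)"

text \<open>All power sums are evaluated at an arbitrary sequence \<open>z\<^sub>0, z\<^sub>1, \<dots>\<close> of power series (only
  meaningful when the sum converges); the symmetric functions themselves arise for
  \<open>z = mps_var\<close>.\<close>

definition psum :: "nat \<Rightarrow> (nat \<Rightarrow> ('v, qbeta) mps) \<Rightarrow> ('v, qbeta) mps" where
  "psum n z = (\<Sum>\<^sub>\<infinity>i. z i ^ n)"

definition psum_round :: "nat \<Rightarrow> (nat \<Rightarrow> ('v, qbeta) mps) \<Rightarrow> ('v, qbeta) mps" where
  "psum_round n z = psum n (\<lambda>i. z i / (1 + mps_const (beta / 2) * z i))"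

definition psum_square :: "nat \<Rightarrow> (nat \<Rightarrow> ('v, qbeta) mps) \<Rightarrow> ('v, qbeta) mps" where
  "psum_square n z =
    (\<Sum>k<n. mps_const (of_nat (n choose k) * (beta / 2) ^ k) * psum (n - k) z)"

definition p_plain :: "nat multiset \<Rightarrow> (nat \<Rightarrow> ('v, qbeta) mps) \<Rightarrow> ('v, qbeta) mps" where
  "p_plain \<mu> z = (\<Prod>i\<in>#\<mu>. psum i z)"

definition p_round :: "nat multiset \<Rightarrow> (nat \<Rightarrow> ('v, qbeta) mps) \<Rightarrow> ('v, qbeta) mps" where
  "p_round \<mu> z = (\<Prod>i\<in>#\<mu>. psum_round i z)"

definition p_square :: "nat multiset \<Rightarrow> (nat \<Rightarrow> ('v, qbeta) mps) \<Rightarrow> ('v, qbeta) mps" where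
  "p_square \<mu> z = (\<Prod>i\<in>#\<mu>. psum_square i z)"


section \<open>The algebras and the bilinear form\<close>

type_synonym series = "(nat, qbeta) mps"

definition Lambda_hat :: "series set" where
  "Lambda_hat =
    {f. \<exists>c. ((\<lambda>\<mu>. mps_const (c \<mu>) * p_plain \<mu> mps_var) has_sum f) Partitions}"

definition Lambda :: "series set" where
  "Lambda =
    {f. (\<forall>\<pi> m. bij \<pi> \<longrightarrow> mps_nth f (image_mset \<pi> m) = mps_nth f m) \<and>
        (\<exists>d. \<forall>m. mps_nth f m \<noteq> 0 \<longrightarrow> size m \<le> d)}"

text \<open>Variables are numbered from 0, and the variable number 0 plays the role of \<open>t\<close>; the variable
  number 1 does not occur after the substitution. Both substitutions converge: in the first one
  all substituted series have zero constant term, in the second one the degree of \<open>f\<close> is bounded.\<close>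

definition GGamma :: "series set" where
  "GGamma = {f \<in> Lambda_hat.
     mps_indep 0 (mps_subst (mps_var(1 := bar (mps_var 0))) f)}"

definition gGamma :: "series set" where
  "gGamma = {f \<in> Lambda.
     mps_indep 0 (mps_subst (mps_var(1 := - mps_var 0 - mps_const beta)) f)}"

text \<open>Coordinates with respect to the (topological, respectively ordinary) bases
  \<open>p\<^sub>\<mu>\<^sup>(\<^sup>\<beta>\<^sup>)\<close> and \<open>p\<^sub>\<mu>\<^sup>[\<^sup>\<beta>\<^sup>]\<close> with \<open>\<mu> \<in> OP\<close>.\<close>

definition coords_round :: "series \<Rightarrow> nat multiset \<Rightarrow> qbeta" where
  "coords_round f = (THE c. (\<forall>\<mu>. \<mu> \<notin> OP \<longrightarrow> c \<mu> = 0) \<and>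
     ((\<lambda>\<mu>. mps_const (c \<mu>) * p_round \<mu> mps_var) has_sum f) OP)"

definition coords_square :: "series \<Rightarrow> nat multiset \<Rightarrow> qbeta" where
  "coords_square g = (THE d. (\<forall>\<mu>. \<mu> \<notin> OP \<longrightarrow> d \<mu> = 0) \<and> finite {\<mu>. d \<mu> \<noteq> 0} \<and>
     g = (\<Sum>\<mu> | d \<mu> \<noteq> 0. mps_const (d \<mu>) * p_square \<mu> mps_var))"

text \<open>The bilinear form on \<open>GGamma \<times> gGamma\<close> with
  \<open>\<langle>p\<^sub>\<mu>\<^sup>(\<^sup>\<beta>\<^sup>), p\<^sub>\<nu>\<^sup>[\<^sup>\<beta>\<^sup>]\<rangle> = 2\<^sup>-\<^sup>\<ell>\<^sup>(\<^sup>\<mu>\<^sup>) z\<^sub>\<mu> \<delta>\<^sub>\<mu>\<^sub>\<nu>\<close>, extended to infinite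
  linear combinations in the first argument.\<close>

definition pairing :: "series \<Rightarrow> series \<Rightarrow> qbeta" where
  "pairing f g = (\<Sum>\<mu> | coords_square g \<mu> \<noteq> 0.
     coords_round f \<mu> * coords_square g \<mu> * (of_nat (z_part \<mu>) / 2 ^ size \<mu>))"

definition dual_families :: "'i set \<Rightarrow> ('i \<Rightarrow> series) \<Rightarrow> ('i \<Rightarrow> series) \<Rightarrow> bool" where
  "dual_families I u v \<longleftrightarrow>
     (\<forall>i\<in>I. u i \<in> GGamma \<and> v i \<in> gGamma) \<and>
     (\<forall>i\<in>I. \<forall>j\<in>I. pairing (u i) (v j) = (if i = j then 1 else 0))"

definition xv :: "nat \<Rightarrow> (nat + nat, qbeta) mps" where
  "xv i = mps_var (Inl i)"

definition yv :: "nat \<Rightarrow> (nat + nat, qbeta) mps" where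
  "yv j = mps_var (Inr j)"

definition is_Cauchy_kernel ::
    "'i set \<Rightarrow> ('i \<Rightarrow> series) \<Rightarrow> ('i \<Rightarrow> series) \<Rightarrow> (nat + nat, qbeta) mps \<Rightarrow> bool" where
  "is_Cauchy_kernel I u v K \<longleftrightarrow> dual_families I u v \<and>
     ((\<lambda>i. mps_subst xv (u i) * mps_subst yv (v i)) has_sum K) I"

end

theory Submission
  imports Defs
begin

text \<open>
  Put \<open>c = \<beta>/2\<close> and \<open>w = x/(1 + c x)\<close>. Then \<open>x = w/(1 - c w)\<close> and the map \<open>x \<mapsto> bar x\<close> becomes
  \<open>w \<mapsto> -w\<close>, so the factor of the product at \<open>(i, j)\<close> is \<open>(1 + a)(1 - b) / ((1 - a)(1 + b))\<close> with
  \<open>a = w (y + c)\<close> and \<open>b = w c\<close>, whose logarithm is the sum of \<open>2/n (a\<^sup>n - b\<^sup>n)\<close> over odd \<open>n\<close>.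
  Summing \<open>a\<^sup>n - b\<^sup>n = w\<^sup>n ((y + c)\<^sup>n - c\<^sup>n)\<close> over all \<open>(i, j)\<close> yields the product of the two deformed
  power sums. The exponential is handled without logarithms: it is the sum over odd partitions with
  weights \<open>2\<^sup>\<ell> / z\<close>, which is multiplicative in the family of power sums by a binomial identity
  for multisets, and its value at \<open>n \<mapsto> a\<^sup>n\<close> is \<open>(1 + a)/(1 - a)\<close>.

  The coordinates that define the pairing are well defined because the lowest homogeneous component
  of \<open>p\<^sub>\<mu>\<^sup>(\<^sup>\<beta>\<^sup>)\<close> and the highest one of \<open>p\<^sub>\<mu>\<^sup>[\<^sup>\<beta>\<^sup>]\<close> are both \<open>p\<^sub>\<mu>\<close>, and the \<open>p\<^sub>\<mu>\<close> are triangular with respect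
  to the coefficients at monomials with exponents \<open>\<mu>\<close>, ordered by length.
\<close>

section \<open>Coefficients and infinite sums\<close>

text \<open>The regrouping into \<open>a ^ n - b ^ n\<close> is forced by convergence. Since
  \<open>c\<close> is a nonzero scalar, the sum of \<open>(y + c) ^ n\<close> over infinitely many
  \<open>y\<close> diverges, and so does the product of the factors
  \<open>(1 + a) / (1 - a)\<close>; only the differences can be summed over all
  \<open>(i, j)\<close>. Hence the exponentials for \<open>a\<close> and \<open>b\<close> are
  compared for one fixed pair, and infinite families enter only through the difference. The same
  scalar explains why two notions of substitution occur: \<open>bar x\<close> has no constant term,
  so every series may be evaluated there, while \<open>- y - beta\<close> has one, so convergence
  has to be carried along as part of the relation \<open>has_subst\<close>. All convergence is
  reduced to finite sums of coefficients at one monomial.\<close>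

lemma mps_nth_simps [simp]:
  fixes f g :: "('v, 'a::comm_ring_1) mps"
  shows "mps_nth (0 :: ('v, 'a) mps) m = 0"
    and "mps_nth (1 :: ('v, 'a) mps) m = (if m = {#} then 1 else 0)"
    and "mps_nth (f + g) m = mps_nth f m + mps_nth g m"
    and "mps_nth (f - g) m = mps_nth f m - mps_nth g m"
    and "mps_nth (- f) m = - mps_nth f m"
    and "mps_nth (mps_const c :: ('v, 'a) mps) m = (if m = {#} then c else 0)"
    and "mps_nth (mps_var i :: ('v, 'a) mps) m = (if m = {#i#} then 1 else 0)"
  by (simp_all add: zero_mps_def one_mps_def plus_mps_def minus_mps_def uminus_mps_def
      mps_const_def mps_var_def)

lemma mps_nth_mult:
  "mps_nth (f * g) m = (\<Sum>a | a \<subseteq># m. mps_nth f a * mps_nth g (m - a))"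
  for f g :: "('v, 'a::comm_ring_1) mps"
  by (simp add: times_mps_def)

lemma mps_nth_sum [simp]: "mps_nth (sum f A) m = (\<Sum>x\<in>A. mps_nth (f x) m)"
  for f :: "_ \<Rightarrow> ('v, 'a::comm_ring_1) mps"
  by (induction A rule: infinite_finite_induct) auto

lemma mps_nth_const_mult [simp]: "mps_nth (mps_const c * f) m = c * mps_nth f m"
  for f :: "('v, 'a::comm_ring_1) mps"
proof -
  have "mps_nth (mps_const c * f) m = (\<Sum>a | a \<subseteq># m. if a = {#} then c * mps_nth f m else 0)"
    unfolding mps_nth_mult by (rule sum.cong) auto
  then show ?thesis by (simp add: finite_submultisets)
qed

lemma mps_nth_mult_nonzeroE:
  fixes f g :: "('v, 'a::comm_ring_1) mps"
  assumes "mps_nth (f * g) m \<noteq> 0"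
  obtains a where "a \<subseteq># m" "mps_nth f a \<noteq> 0" "mps_nth g (m - a) \<noteq> 0"
proof -
  obtain a where "a \<in> {a. a \<subseteq># m}" "mps_nth f a * mps_nth g (m - a) \<noteq> 0"
    using assms unfolding mps_nth_mult by (rule sum.not_neutral_contains_not_neutral)
  then show thesis by (intro that[of a]) auto
qed

lemma mps_nth_mult_empty: "mps_nth (f * g) {#} = mps_nth f {#} * mps_nth g {#}"
  for f g :: "('v, 'a::comm_ring_1) mps"
  by (simp add: mps_nth_mult)

lemma mps_const_hom [simp]:
  "mps_const 0 = (0 :: ('v, 'a::comm_ring_1) mps)"
  "mps_const 1 = (1 :: ('v, 'a) mps)"
  "mps_const (c + d) = (mps_const c + mps_const d :: ('v, 'a) mps)"
  "mps_const (c - d) = (mps_const c - mps_const d :: ('v, 'a) mps)"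
  "mps_const (- c) = (- mps_const c :: ('v, 'a) mps)"
  by (rule mps_eqI; simp)+

lemma mps_const_mult: "mps_const (c * d) = (mps_const c * mps_const d :: ('v, 'a::comm_ring_1) mps)"
  by (rule mps_eqI) simp

lemma mps_const_power: "mps_const (c ^ n) = (mps_const c ^ n :: ('v, 'a::comm_ring_1) mps)"
  by (induction n) (simp_all add: mps_const_mult)

lemma mps_const_of_nat: "mps_const (of_nat n) = (of_nat n :: ('v, 'a::comm_ring_1) mps)"
  by (induction n) simp_all

text \<open>Locality: the coefficient at \<open>m\<close> only sees divisors of \<open>m\<close>.
  This is what later allows an infinite family to be replaced by a finite partial sum.\<close>

lemma mps_nth_mult_cong:
  fixes f g f' g' :: "('v, 'a::comm_ring_1) mps"
  assumes "\<And>a. a \<subseteq># m \<Longrightarrow> mps_nth f a = mps_nth f' a" "\<And>a. a \<subseteq># m \<Longrightarrow> mps_nth g a = mps_nth g' a"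
  shows "mps_nth (f * g) m = mps_nth (f' * g') m"
  unfolding mps_nth_mult by (rule sum.cong) (auto simp: assms)

lemma mps_nth_prod_mset_cong:
  fixes q q' :: "'i \<Rightarrow> ('v, 'a::comm_ring_1) mps"
  assumes "\<And>i b. i \<in># \<mu> \<Longrightarrow> b \<subseteq># m \<Longrightarrow> mps_nth (q i) b = mps_nth (q' i) b"
  shows "mps_nth (\<Prod>i\<in>#\<mu>. q i) m = mps_nth (\<Prod>i\<in>#\<mu>. q' i) m"
  using assms
proof (induction \<mu> arbitrary: m)
  case (add i \<mu>)
  show ?case
    unfolding image_mset_add_mset prod_mset.add_mset
  proof (rule mps_nth_mult_cong)
    fix a assume a: "a \<subseteq># m"
    show "mps_nth (q i) a = mps_nth (q' i) a"
      by (rule add.prems) (use a in simp_all)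
    show "mps_nth (\<Prod>i\<in>#\<mu>. q i) a = mps_nth (\<Prod>i\<in>#\<mu>. q' i) a"
    proof (rule add.IH)
      fix j b assume "j \<in># \<mu>" "b \<subseteq># a"
      then show "mps_nth (q j) b = mps_nth (q' j) b"
        using a add.prems[of j b] subset_mset.order_trans by auto
    qed
  qed
qed simp

text \<open>Convergence means that each coefficient is eventually constant along finite subsets. For
  a formal sum this amounts to finite support at every monomial, so infinite sums can be handled as
  finite ones.\<close>

lemma has_sum_mps_iff:
  fixes f :: "'i \<Rightarrow> ('v, 'a::comm_ring_1) mps"
  shows "(f has_sum F) A \<longleftrightarrow> (\<forall>m. \<exists>B. finite B \<and> B \<subseteq> A \<and>
    (\<forall>x\<in>A - B. mps_nth (f x) m = 0) \<and> mps_nth F m = (\<Sum>x\<in>B. mps_nth (f x) m))"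
  unfolding has_sum_def tendsto_mps_iff eventually_finite_subsets_at_top
proof (rule iff_allI, rule iffI)
  fix m
  assume "\<exists>X. finite X \<and> X \<subseteq> A \<and>
    (\<forall>Y. finite Y \<and> X \<subseteq> Y \<and> Y \<subseteq> A \<longrightarrow> mps_nth (sum f Y) m = mps_nth F m)"
  then obtain X where X: "finite X" "X \<subseteq> A"
    and F: "\<forall>Y. finite Y \<and> X \<subseteq> Y \<and> Y \<subseteq> A \<longrightarrow> mps_nth (sum f Y) m = mps_nth F m"
    by (elim exE conjE)
  have FX: "mps_nth (sum f X) m = mps_nth F m"
    using F X by simp
  have "mps_nth (f x) m = 0" if x: "x \<in> A - X" for x
  proof -
    \<comment> \<open>Enlarging the stable set by the single index \<open>x\<close> isolates the
      coefficient of \<open>f x\<close>.\<close>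
    have "mps_nth (sum f (insert x X)) m = mps_nth F m"
      using F[rule_format, of "insert x X"] X x by blast
    with FX x X(1) show ?thesis by simp
  qed
  with X FX show "\<exists>B. finite B \<and> B \<subseteq> A \<and>
    (\<forall>x\<in>A - B. mps_nth (f x) m = 0) \<and> mps_nth F m = (\<Sum>x\<in>B. mps_nth (f x) m)"
    by (intro exI[of _ X]) simp
next
  fix m
  assume "\<exists>B. finite B \<and> B \<subseteq> A \<and>
    (\<forall>x\<in>A - B. mps_nth (f x) m = 0) \<and> mps_nth F m = (\<Sum>x\<in>B. mps_nth (f x) m)"
  then obtain B where B: "finite B" "B \<subseteq> A" "\<forall>x\<in>A - B. mps_nth (f x) m = 0"
    and F: "mps_nth F m = (\<Sum>x\<in>B. mps_nth (f x) m)" by (elim exE conjE)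
  have "mps_nth (sum f Y) m = mps_nth F m" if "finite Y" "B \<subseteq> Y" "Y \<subseteq> A" for Y
    using B(3) that unfolding mps_nth_sum F by (intro sum.mono_neutral_right) auto
  with B show "\<exists>X. finite X \<and> X \<subseteq> A \<and>
    (\<forall>Y. finite Y \<and> X \<subseteq> Y \<and> Y \<subseteq> A \<longrightarrow> mps_nth (sum f Y) m = mps_nth F m)"
    by (intro exI[of _ B]) simp
qed

lemma has_sum_mpsI:
  fixes f :: "'i \<Rightarrow> ('v, 'a::comm_ring_1) mps"
  assumes "\<And>m. finite (B m)" "\<And>m. B m \<subseteq> A"
    and "\<And>m x. x \<in> A \<Longrightarrow> x \<notin> B m \<Longrightarrow> mps_nth (f x) m = 0"
    and "\<And>m. mps_nth F m = (\<Sum>x\<in>B m. mps_nth (f x) m)"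
  shows "(f has_sum F) A"
  unfolding has_sum_mps_iff
proof
  fix m
  show "\<exists>B. finite B \<and> B \<subseteq> A \<and>
      (\<forall>x\<in>A - B. mps_nth (f x) m = 0) \<and> mps_nth F m = (\<Sum>x\<in>B. mps_nth (f x) m)"
    by (rule exI[of _ "B m"]) (simp add: assms)
qed

lemma has_sum_mps_nth:
  fixes f :: "'i \<Rightarrow> ('v, 'a::comm_ring_1) mps"
  assumes "(f has_sum F) A" "finite B" "\<And>x. x \<in> A \<Longrightarrow> x \<notin> B \<Longrightarrow> mps_nth (f x) m = 0"
    and "B \<subseteq> A"
  shows "mps_nth F m = (\<Sum>x\<in>B. mps_nth (f x) m)"
proof -
  obtain C where C: "finite C" "C \<subseteq> A" "\<forall>x\<in>A - C. mps_nth (f x) m = 0"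
    and F: "mps_nth F m = (\<Sum>x\<in>C. mps_nth (f x) m)"
    using assms(1)[unfolded has_sum_mps_iff, rule_format, of m] by (elim exE conjE)
  show ?thesis
    unfolding F using assms(2-4) C by (intro sum.mono_neutral_cong) auto
qed

lemma has_sum_mps_nth_supp:
  fixes f :: "'i \<Rightarrow> ('v, 'a::comm_ring_1) mps"
  assumes "(f has_sum F) A"
  shows "finite {x\<in>A. mps_nth (f x) m \<noteq> 0}"
    and "mps_nth F m = (\<Sum>x | x \<in> A \<and> mps_nth (f x) m \<noteq> 0. mps_nth (f x) m)"
proof -
  obtain C where C: "finite C" "C \<subseteq> A" "\<forall>x\<in>A - C. mps_nth (f x) m = 0"
    and "mps_nth F m = (\<Sum>x\<in>C. mps_nth (f x) m)"
    using assms[unfolded has_sum_mps_iff, rule_format, of m] by (elim exE conjE)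
  have "{x\<in>A. mps_nth (f x) m \<noteq> 0} \<subseteq> C" using C(3) by blast
  then show fin: "finite {x\<in>A. mps_nth (f x) m \<noteq> 0}" using C(1) finite_subset by blast
  show "mps_nth F m = (\<Sum>x | x \<in> A \<and> mps_nth (f x) m \<noteq> 0. mps_nth (f x) m)"
    by (rule has_sum_mps_nth[OF assms fin]) auto
qed

lemma summable_on_mpsI:
  fixes f :: "'i \<Rightarrow> ('v, 'a::comm_ring_1) mps"
  assumes "\<And>m. finite {x\<in>A. mps_nth (f x) m \<noteq> 0}"
  shows "f summable_on A"
proof -
  have "(f has_sum Abs_mps (\<lambda>m. \<Sum>x | x \<in> A \<and> mps_nth (f x) m \<noteq> 0. mps_nth (f x) m)) A"
    by (rule has_sum_mpsI[where B = "\<lambda>m. {x\<in>A. mps_nth (f x) m \<noteq> 0}"]) (use assms in auto)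
  then show ?thesis by (rule has_sum_imp_summable)
qed

lemma has_sum_mps_nonzeroE:
  fixes f :: "'i \<Rightarrow> ('v, 'a::comm_ring_1) mps"
  assumes "(f has_sum F) A" "mps_nth F m \<noteq> 0"
  obtains x where "x \<in> A" "mps_nth (f x) m \<noteq> 0"
  using has_sum_mps_nth[OF assms(1), of "{}" m] assms(2) by auto

lemma has_sum_mps_diff:
  fixes f g :: "'i \<Rightarrow> ('v, 'a::comm_ring_1) mps"
  assumes f: "(f has_sum F) A" and g: "(g has_sum G) A"
  shows "((\<lambda>x. f x - g x) has_sum (F - G)) A"
proof (rule has_sum_mpsI)
  let ?B = "\<lambda>m. {x\<in>A. mps_nth (f x) m \<noteq> 0} \<union> {x\<in>A. mps_nth (g x) m \<noteq> 0}"
  fix m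
  show "finite (?B m)" using f g by (simp add: has_sum_mps_nth_supp)
  show "mps_nth (F - G) m = (\<Sum>x\<in>?B m. mps_nth (f x - g x) m)"
    using has_sum_mps_nth[OF f \<open>finite (?B m)\<close>, of m] has_sum_mps_nth[OF g \<open>finite (?B m)\<close>, of m]
    by (auto simp: sum_subtractf)
qed auto

lemma has_sum_mps_add:
  fixes f g :: "'i \<Rightarrow> ('v, 'a::comm_ring_1) mps"
  assumes f: "(f has_sum F) A" and g: "(g has_sum G) A"
  shows "((\<lambda>x. f x + g x) has_sum (F + G)) A"
proof -
  have "((\<lambda>x. 0 - g x) has_sum (0 - G)) A"
    by (intro has_sum_mps_diff[OF _ g]) (rule has_sum_mpsI[where B = "\<lambda>_. {}"]; simp)
  from has_sum_mps_diff[OF f this] show ?thesis by simp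
qed

text \<open>A monomial has finitely many divisors, and each divisor meets finitely many terms of
  either family; the rectangle of these indices supports the coefficient at
  \<open>m\<close>.\<close>

lemma has_sum_mps_times:
  fixes f :: "'i \<Rightarrow> ('v, 'a::comm_ring_1) mps"
  assumes f: "(f has_sum F) A" and g: "(g has_sum G) B"
  shows "((\<lambda>(x, y). f x * g y) has_sum (F * G)) (A \<times> B)"
proof (rule has_sum_mpsI)
  define S where "S m = (\<Union>b\<in>{b. b \<subseteq># m}. {x\<in>A. mps_nth (f x) b \<noteq> 0})" for m
  define T where "T m = (\<Union>b\<in>{b. b \<subseteq># m}. {x\<in>B. mps_nth (g x) b \<noteq> 0})" for m
  fix m
  have S: "finite (S m)" "S m \<subseteq> A" and T: "finite (T m)" "T m \<subseteq> B"
    using f g by (auto simp: S_def T_def finite_submultisets has_sum_mps_nth_supp)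
  show "finite (S m \<times> T m)" "S m \<times> T m \<subseteq> A \<times> B" using S T by auto
  show "mps_nth ((\<lambda>(x, y). f x * g y) p) m = 0" if "p \<in> A \<times> B" "p \<notin> S m \<times> T m" for p
  proof (rule ccontr)
    assume "mps_nth ((\<lambda>(x, y). f x * g y) p) m \<noteq> 0"
    then obtain a where "a \<subseteq># m" "mps_nth (f (fst p)) a \<noteq> 0" "mps_nth (g (snd p)) (m - a) \<noteq> 0"
      by (auto simp: case_prod_unfold elim: mps_nth_mult_nonzeroE)
    then have "fst p \<in> S m" "snd p \<in> T m"
      using that(1) unfolding S_def T_def by (auto intro: exI[of _ a] exI[of _ "m - a"])
    then have "p \<in> S m \<times> T m" by (simp add: mem_Times_iff)
    with that(2) show False ..
  qed
  have "(\<Sum>p\<in>S m \<times> T m. mps_nth ((\<lambda>(x, y). f x * g y) p) m) =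
    (\<Sum>p\<in>S m \<times> T m. \<Sum>a | a \<subseteq># m. mps_nth (f (fst p)) a * mps_nth (g (snd p)) (m - a))"
    by (simp add: case_prod_unfold mps_nth_mult)
  also have "\<dots> = (\<Sum>a | a \<subseteq># m. (\<Sum>x\<in>S m. mps_nth (f x) a) * (\<Sum>y\<in>T m. mps_nth (g y) (m - a)))"
    by (subst sum.swap) (simp add: sum_product sum.cartesian_product case_prod_unfold)
  also have "\<dots> = mps_nth (F * G) m"
    unfolding mps_nth_mult
  proof (rule sum.cong[OF refl], rule arg_cong2[where f = "(*)"])
    fix a assume a: "a \<in> {a. a \<subseteq># m}"
    show "(\<Sum>x\<in>S m. mps_nth (f x) a) = mps_nth F a"
      using a S(2) by (intro has_sum_mps_nth[OF f S(1), symmetric]) (auto simp: S_def)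
    show "(\<Sum>y\<in>T m. mps_nth (g y) (m - a)) = mps_nth G (m - a)"
      using a T(2) by (intro has_sum_mps_nth[OF g T(1), symmetric]) (auto simp: T_def)
  qed
  finally show "mps_nth (F * G) m = (\<Sum>p\<in>S m \<times> T m. mps_nth ((\<lambda>(x, y). f x * g y) p) m)" ..
qed

lemma has_sum_mps_cmult:
  fixes f :: "'i \<Rightarrow> ('v, 'a::comm_ring_1) mps"
  assumes "(f has_sum F) A"
  shows "((\<lambda>x. c * f x) has_sum (c * F)) A"
proof -
  have "((\<lambda>(u::unit, x). c * f x) has_sum (c * F)) ({()} \<times> A)"
    by (rule has_sum_mps_times[OF _ assms]) (simp add: has_sum_finiteI)
  then show ?thesis
    by (subst (asm) has_sum_reindex_bij_betw[symmetric, where g = "\<lambda>x. ((), x)" and A = A])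
      (auto simp: bij_betw_def inj_on_def)
qed

text \<open>Cancellation inside a fibre can only shrink the support, so the projection of the
  support of \<open>f\<close> is still a valid finite range.\<close>

lemma has_sum_mps_fibers:
  fixes f :: "'i \<times> 'j \<Rightarrow> ('v, 'a::comm_ring_1) mps"
  assumes f: "(f has_sum F) (Sigma A B)" and B: "\<And>x. x \<in> A \<Longrightarrow> finite (B x)"
  shows "((\<lambda>x. \<Sum>y\<in>B x. f (x, y)) has_sum F) A"
proof (rule has_sum_mpsI)
  let ?S = "\<lambda>m. fst ` {p \<in> Sigma A B. mps_nth (f p) m \<noteq> 0}"
  fix m
  show fin: "finite (?S m)" using f by (simp add: has_sum_mps_nth_supp)
  show "mps_nth (\<Sum>y\<in>B x. f (x, y)) m = 0" if "x \<in> A" "x \<notin> ?S m" for x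
    using that by (force intro: sum.neutral)
  have S: "?S m \<subseteq> A" by auto
  have "mps_nth F m = (\<Sum>p\<in>Sigma (?S m) B. mps_nth (f p) m)"
    by (rule has_sum_mps_nth[OF f]) (use fin S B in \<open>auto intro!: finite_SigmaI image_eqI[of _ fst]\<close>)
  also have "\<dots> = (\<Sum>x\<in>?S m. \<Sum>y\<in>B x. mps_nth (f (x, y)) m)"
    using fin S B by (subst sum.Sigma) (auto simp: subset_iff)
  finally show "mps_nth F m = (\<Sum>x\<in>?S m. mps_nth (\<Sum>y\<in>B x. f (x, y)) m)" by simp
qed auto

text \<open>Cauchy product over the free commutative monoid of multisets: pairs are grouped by their
  union, and the fibre over \<open>\<mu>\<close> is the finite set of its submultisets. It yields
  multiplicativity both of substitution and of the exponential.\<close>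

lemma has_sum_mps_convolution:
  fixes f g :: "'i multiset \<Rightarrow> ('v, 'a::comm_ring_1) mps"
  assumes "(f has_sum F) UNIV" "(g has_sum G) UNIV"
  shows "((\<lambda>\<mu>. \<Sum>\<nu> | \<nu> \<subseteq># \<mu>. f \<nu> * g (\<mu> - \<nu>)) has_sum (F * G)) UNIV"
proof -
  have "((\<lambda>(\<mu>, \<nu>). f \<nu> * g (\<mu> - \<nu>)) has_sum (F * G)) (SIGMA \<mu>:UNIV. {\<nu>. \<nu> \<subseteq># \<mu>}) \<longleftrightarrow>
    ((\<lambda>(x, y). f x * g y) has_sum (F * G)) (UNIV \<times> UNIV)"
    by (rule has_sum_reindex_bij_witness[of _ "\<lambda>(\<nu>, \<kappa>). (\<nu> + \<kappa>, \<nu>)" "\<lambda>(\<mu>, \<nu>). (\<nu>, \<mu> - \<nu>)"]) auto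
  with has_sum_mps_times[OF assms] show ?thesis
    using has_sum_mps_fibers[of "\<lambda>(\<mu>, \<nu>). f \<nu> * g (\<mu> - \<nu>)" UNIV "\<lambda>\<mu>. {\<nu>. \<nu> \<subseteq># \<mu>}" "F * G"]
    by (simp add: finite_submultisets)
qed

section \<open>Substitution\<close>

text \<open>Unlike \<^const>\<open>mps_subst\<close>, this records that the substitution converges, which makes it
  compatible with the ring operations.\<close>

definition has_subst ::
    "('v \<Rightarrow> ('w, 'a::comm_ring_1) mps) \<Rightarrow> ('v, 'a) mps \<Rightarrow> ('w, 'a) mps \<Rightarrow> bool" where
  "has_subst z f F \<longleftrightarrow> ((\<lambda>a. mps_const (mps_nth f a) * (\<Prod>i\<in>#a. z i)) has_sum F) UNIV"

lemma has_subst_imp_eq: "has_subst z f F \<Longrightarrow> mps_subst z f = F"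
  unfolding has_subst_def mps_subst_def by (rule infsumI)

lemma has_sum_single:
  fixes f :: "'i \<Rightarrow> 'b::{comm_monoid_add, t2_space}"
  assumes "\<And>y. y \<in> A \<Longrightarrow> y \<noteq> x \<Longrightarrow> f y = 0" "x \<in> A" "F = f x"
  shows "(f has_sum F) A"
proof -
  have "(f has_sum F) {x}" by (rule has_sum_finiteI) (simp_all add: assms)
  then show ?thesis
    by (subst has_sum_cong_neutral[where T = "{x}" and g = f]) (use assms in auto)
qed

lemma has_subst_mult:
  assumes "has_subst z f F" "has_subst z g G"
  shows "has_subst z (f * g) (F * G)"
proof -
  have "(\<Sum>\<nu> | \<nu> \<subseteq># \<mu>. mps_const (mps_nth f \<nu>) * (\<Prod>i\<in>#\<nu>. z i) *
      (mps_const (mps_nth g (\<mu> - \<nu>)) * (\<Prod>i\<in>#\<mu> - \<nu>. z i))) =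
    mps_const (mps_nth (f * g) \<mu>) * (\<Prod>i\<in>#\<mu>. z i)" for \<mu>
  proof -
    have c: "mps_const (sum h S) = (\<Sum>x\<in>S. mps_const (h x))" for h :: "'x \<Rightarrow> 'c" and S
      by (rule mps_eqI) simp
    have "(\<Prod>i\<in>#\<nu>. z i) * (\<Prod>i\<in>#\<mu> - \<nu>. z i) = (\<Prod>i\<in>#\<mu>. z i)" if "\<nu> \<subseteq># \<mu>" for \<nu>
      using that by (metis image_mset_union prod_mset.union subset_mset.add_diff_inverse)
    then show ?thesis
      unfolding mps_nth_mult c sum_distrib_right mps_const_mult
      by (intro sum.cong) (auto simp: algebra_simps)
  qed
  then show ?thesis
    using has_sum_mps_convolution[OF assms[unfolded has_subst_def]] by (simp add: has_subst_def)
qed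

lemma has_subst_add:
  assumes "has_subst z f F" "has_subst z g G"
  shows "has_subst z (f + g) (F + G)"
  using has_sum_mps_add[OF assms[unfolded has_subst_def]]
  by (simp add: has_subst_def algebra_simps)

lemma has_subst_const: "has_subst z (mps_const c) (mps_const c)"
  unfolding has_subst_def by (rule has_sum_single[of _ "{#}"]) auto

lemma has_subst_var: "has_subst z (mps_var i) (z i)"
  unfolding has_subst_def by (rule has_sum_single[of _ "{#i#}"]) auto

lemma has_subst_power: "has_subst z f F \<Longrightarrow> has_subst z (f ^ n) (F ^ n)"
  using has_subst_const[of z 1] by (induction n) (auto intro: has_subst_mult)

lemma has_subst_sum:
  "(\<And>x. x \<in> A \<Longrightarrow> has_subst z (f x) (F x)) \<Longrightarrow> has_subst z (\<Sum>x\<in>A. f x) (\<Sum>x\<in>A. F x)"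
  using has_subst_const[of z 0]
  by (induction A rule: infinite_finite_induct) (auto intro: has_subst_add)

lemma has_subst_prod_mset:
  "(\<And>x. x \<in># A \<Longrightarrow> has_subst z (f x) (F x)) \<Longrightarrow> has_subst z (\<Prod>x\<in>#A. f x) (\<Prod>x\<in>#A. F x)"
  using has_subst_const[of z 1] by (induction A) (auto intro: has_subst_mult)

section \<open>Families at which every series can be evaluated\<close>

definition locally_finite :: "('v \<Rightarrow> ('w, 'a::zero) mps) \<Rightarrow> bool" where
  "locally_finite z \<longleftrightarrow> (\<forall>m. finite {i. mps_nth (z i) m \<noteq> 0})"

text \<open>Local finiteness alone makes power sums of positive degree converge; vanishing constant
  terms are added so that series of unbounded degree can be substituted too.\<close>

definition null_family :: "('v \<Rightarrow> ('w, 'a::zero) mps) \<Rightarrow> bool" where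
  "null_family z \<longleftrightarrow> locally_finite z \<and> (\<forall>i. mps_nth (z i) {#} = 0)"

definition relevant :: "('v \<Rightarrow> ('w, 'a::zero) mps) \<Rightarrow> 'w multiset \<Rightarrow> 'v set" where
  "relevant z m = {i. \<exists>b. b \<subseteq># m \<and> mps_nth (z i) b \<noteq> 0}"

lemma finite_relevant: "locally_finite z \<Longrightarrow> finite (relevant z m)"
proof -
  assume "locally_finite z"
  then have "finite (\<Union>b\<in>{b. b \<subseteq># m}. {i. mps_nth (z i) b \<noteq> 0})"
    by (simp add: locally_finite_def finite_submultisets)
  also have "(\<Union>b\<in>{b. b \<subseteq># m}. {i. mps_nth (z i) b \<noteq> 0}) = relevant z m"
    by (auto simp: relevant_def)
  finally show ?thesis .
qed

lemma finite_multisets_bounded: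
  assumes "finite I"
  shows "finite {a. set_mset a \<subseteq> I \<and> size a \<le> N}"
proof (rule finite_subset[OF _ finite_submultisets])
  show "{a. set_mset a \<subseteq> I \<and> size a \<le> N} \<subseteq> {a. a \<subseteq># (\<Sum>i\<in>I. replicate_mset N i)}"
  proof (intro subsetI CollectI mset_subset_eqI)
    fix a i assume a: "a \<in> {a. set_mset a \<subseteq> I \<and> size a \<le> N}"
    show "count a i \<le> count (\<Sum>i\<in>I. replicate_mset N i) i"
    proof (cases "i \<in># a")
      case True
      with a have "i \<in> I" by auto
      have "count a i \<le> N" using a count_le_size[of a i] by simp
      also have "\<dots> = count (\<Sum>i\<in>I. replicate_mset N i) i"
        using \<open>i \<in> I\<close> assms by (simp add: count_sum)
      finally show ?thesis .
    qed (simp add: not_in_iff)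
  qed
qed

lemma mps_nth_prod_mset_nonzero_relevant:
  fixes z :: "'v \<Rightarrow> ('w, 'a::comm_ring_1) mps"
  assumes "mps_nth (\<Prod>i\<in>#a. z i) m \<noteq> 0"
  shows "set_mset a \<subseteq> relevant z m"
  using assms
proof (induction a arbitrary: m)
  case (add i a)
  then obtain b where b: "b \<subseteq># m" "mps_nth (z i) b \<noteq> 0" "mps_nth (\<Prod>i\<in>#a. z i) (m - b) \<noteq> 0"
    by (auto elim: mps_nth_mult_nonzeroE)
  have "relevant z (m - b) \<subseteq> relevant z m"
    using subset_mset.order_trans[OF _ diff_subset_eq_self] unfolding relevant_def by blast
  with add.IH[OF b(3)] b(1,2) show ?case by (auto simp: relevant_def)
qed simp

lemma mps_nth_prod_mset_nonzero_size:
  fixes z :: "'v \<Rightarrow> ('w, 'a::comm_ring_1) mps"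
  assumes "mps_nth (\<Prod>i\<in>#a. z i) m \<noteq> 0" "\<And>i. mps_nth (z i) {#} = 0"
  shows "size a \<le> size m"
  using assms(1)
proof (induction a arbitrary: m)
  case (add i a)
  then obtain b where b: "b \<subseteq># m" "mps_nth (z i) b \<noteq> 0" "mps_nth (\<Prod>i\<in>#a. z i) (m - b) \<noteq> 0"
    by (auto elim: mps_nth_mult_nonzeroE)
  have "b \<noteq> {#}" using b(2) assms(2) by auto
  then have "size b > 0" by (simp add: nonempty_has_size)
  moreover have "size b \<le> size m" using b(1) by (rule size_mset_mono)
  ultimately show ?case
    unfolding size_add_mset using add.IH[OF b(3)] size_Diff_submset[OF b(1)] by linarith
qed simp

text \<open>A finite range for the coefficient at \<open>m\<close>: local finiteness limits the
  letters of the monomials, vanishing constant terms limit their length.\<close>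

definition subst_support :: "('v \<Rightarrow> ('w, 'a::zero) mps) \<Rightarrow> 'w multiset \<Rightarrow> 'v multiset set" where
  "subst_support z m = {a. set_mset a \<subseteq> relevant z m \<and> size a \<le> size m}"

lemma finite_subst_support: "null_family z \<Longrightarrow> finite (subst_support z m)"
  unfolding subst_support_def null_family_def
  by (intro finite_multisets_bounded finite_relevant) simp

lemma mps_nth_prod_mset_eq_0:
  fixes z :: "'v \<Rightarrow> ('w, 'a::comm_ring_1) mps"
  assumes "null_family z" "a \<notin> subst_support z m"
  shows "mps_nth (\<Prod>i\<in>#a. z i) m = 0"
  using assms mps_nth_prod_mset_nonzero_relevant[of z a m] mps_nth_prod_mset_nonzero_size[of z a m]
  by (auto simp: subst_support_def null_family_def)

lemma has_subst_null:
  fixes z :: "'v \<Rightarrow> ('w, 'a::comm_ring_1) mps"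
  assumes z: "null_family z"
  shows "has_subst z f (mps_subst z f)"
  unfolding has_subst_def mps_subst_def
proof (rule has_sum_infsum, rule summable_on_mpsI)
  fix m
  show "finite {a \<in> UNIV. mps_nth (mps_const (mps_nth f a) * (\<Prod>i\<in>#a. z i)) m \<noteq> 0}"
    by (rule finite_subset[OF _ finite_subst_support[OF z, of m]])
      (use mps_nth_prod_mset_eq_0[OF z, of _ m] in force)
qed

text \<open>The range of summation depends on \<open>z\<close> and \<open>m\<close> but not on
  \<open>f\<close>; this uniformity lets substitution commute with infinite sums in
  \<open>mps_subst_has_sum\<close>.\<close>

lemma mps_nth_subst:
  fixes z :: "'v \<Rightarrow> ('w, 'a::comm_ring_1) mps"
  assumes z: "null_family z"
  shows "mps_nth (mps_subst z f) m =
    (\<Sum>a\<in>subst_support z m. mps_nth f a * mps_nth (\<Prod>i\<in>#a. z i) m)"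
proof -
  have "mps_nth (mps_subst z f) m =
    (\<Sum>a\<in>subst_support z m. mps_nth (mps_const (mps_nth f a) * (\<Prod>i\<in>#a. z i)) m)"
    using has_subst_null[OF z, of f] finite_subst_support[OF z] mps_nth_prod_mset_eq_0[OF z]
    unfolding has_subst_def by (intro has_sum_mps_nth) auto
  then show ?thesis by simp
qed

lemma mps_subst_has_sum:
  fixes z :: "'v \<Rightarrow> ('w, 'a::comm_ring_1) mps"
  assumes z: "null_family z" and f: "(f has_sum F) A"
  shows "((\<lambda>x. mps_subst z (f x)) has_sum mps_subst z F) A"
proof (rule has_sum_mpsI)
  let ?B = "\<lambda>m. \<Union>a\<in>subst_support z m. {x\<in>A. mps_nth (f x) a \<noteq> 0}"
  fix m
  show fin: "finite (?B m)"
    using f finite_subst_support[OF z] by (simp add: has_sum_mps_nth_supp)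
  show "?B m \<subseteq> A" by auto
  show "mps_nth (mps_subst z (f x)) m = 0" if "x \<in> A" "x \<notin> ?B m" for x
    using that unfolding mps_nth_subst[OF z] by (intro sum.neutral) auto
  have "mps_nth F a = (\<Sum>x\<in>?B m. mps_nth (f x) a)" if "a \<in> subst_support z m" for a
    by (rule has_sum_mps_nth[OF f fin]) (use that in auto)
  then have "mps_nth (mps_subst z F) m =
    (\<Sum>a\<in>subst_support z m. \<Sum>x\<in>?B m. mps_nth (f x) a * mps_nth (\<Prod>i\<in>#a. z i) m)"
    unfolding mps_nth_subst[OF z] by (simp add: sum_distrib_right)
  also have "\<dots> = (\<Sum>x\<in>?B m. mps_nth (mps_subst z (f x)) m)"
    unfolding mps_nth_subst[OF z] by (rule sum.swap)
  finally show "mps_nth (mps_subst z F) m = (\<Sum>x\<in>?B m. mps_nth (mps_subst z (f x)) m)" .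
qed

lemma mps_subst_null_simps:
  fixes z :: "'v \<Rightarrow> ('w, 'a::comm_ring_1) mps"
  assumes "null_family z"
  shows "mps_subst z (f * g) = mps_subst z f * mps_subst z g"
    and "mps_subst z (f + g) = mps_subst z f + mps_subst z g"
    and "mps_subst z (f ^ n) = mps_subst z f ^ n"
    and "mps_subst z (mps_const c) = mps_const c"
    and "mps_subst z 1 = 1"
    and "mps_subst z (mps_var i) = z i"
    and "mps_subst z (\<Prod>x\<in>#\<mu>. h x) = (\<Prod>x\<in>#\<mu>. mps_subst z (h x))"
proof -
  note null = has_subst_null[OF assms]
  show "mps_subst z (f * g) = mps_subst z f * mps_subst z g"
    by (intro has_subst_imp_eq has_subst_mult null)
  show "mps_subst z (f + g) = mps_subst z f + mps_subst z g"
    by (intro has_subst_imp_eq has_subst_add null)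
  show "mps_subst z (f ^ n) = mps_subst z f ^ n"
    by (intro has_subst_imp_eq has_subst_power null)
  show "mps_subst z (mps_const c) = mps_const c"
    by (intro has_subst_imp_eq has_subst_const)
  show "mps_subst z 1 = 1"
    using has_subst_imp_eq[OF has_subst_const[of z 1]] by simp
  show "mps_subst z (mps_var i) = z i"
    by (intro has_subst_imp_eq has_subst_var)
  show "mps_subst z (\<Prod>x\<in>#\<mu>. h x) = (\<Prod>x\<in>#\<mu>. mps_subst z (h x))"
    by (intro has_subst_imp_eq has_subst_prod_mset null)
qed

section \<open>Geometric series and division\<close>

lemma mps_nth_power_eq_0:
  fixes u :: "('v, 'a::comm_ring_1) mps"
  assumes "mps_nth u {#} = 0" "size m < n"
  shows "mps_nth (u ^ n) m = 0"
proof (rule ccontr)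
  assume "mps_nth (u ^ n) m \<noteq> 0"
  \<comment> \<open>The power is read as a product over \<open>n\<close> copies of the single index
    \<open>()\<close>, so the degree bound for products over multisets applies.\<close>
  then have "size (replicate_mset n ()) \<le> size m"
    using assms(1) by (intro mps_nth_prod_mset_nonzero_size[of "\<lambda>_::unit. u"]) simp_all
  with assms(2) show False by simp
qed

lemma geometric_mps:
  fixes u :: "('v, 'a::comm_ring_1) mps"
  assumes u: "mps_nth u {#} = 0"
  shows "(1 - u) * inverse (1 - u) = 1" and "((\<lambda>n. u ^ n) has_sum inverse (1 - u)) UNIV"
proof -
  \<comment> \<open>Powers beyond the degree of \<open>m\<close> vanish at \<open>m\<close>, so
    cutting off at \<open>size m\<close> already gives the coefficient of the full series.\<close>
  define G where "G = Abs_mps (\<lambda>m. mps_nth (\<Sum>n\<le>size m. u ^ n) m)"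
  have G: "mps_nth G m = mps_nth (\<Sum>n\<le>N. u ^ n) m" if "size m \<le> N" for m N
    unfolding G_def mps_nth_Abs mps_nth_sum
    by (rule sum.mono_neutral_left) (use that mps_nth_power_eq_0[OF u] in auto)
  have "(1 - u) * G = 1"
  proof (rule mps_eqI)
    fix m
    have "mps_nth ((1 - u) * G) m = mps_nth ((1 - u) * (\<Sum>n\<le>size m. u ^ n)) m"
      by (rule mps_nth_mult_cong, simp, rule G, erule size_mset_mono)
    also have "(1 - u) * (\<Sum>n\<le>size m. u ^ n) = 1 - u ^ Suc (size m)"
      by (rule sum_gp_basic)
    finally show "mps_nth ((1 - u) * G) m = mps_nth 1 m"
      using mps_nth_power_eq_0[OF u, of m "Suc (size m)"] by simp
  qed
  then show "(1 - u) * inverse (1 - u) = 1" using mps_inverse_unique by metis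
  have "((\<lambda>n. u ^ n) has_sum G) UNIV"
    by (rule has_sum_mpsI[where B = "\<lambda>m. {..size m}"]) (use mps_nth_power_eq_0[OF u] G in auto)
  with \<open>(1 - u) * G = 1\<close> show "((\<lambda>n. u ^ n) has_sum inverse (1 - u)) UNIV"
    using mps_inverse_unique by metis
qed

lemma mps_mult_inverse:
  fixes f :: "('v, 'a::comm_ring_1) mps"
  assumes "mps_nth f {#} = 1"
  shows "f * inverse f = 1"
  using geometric_mps(1)[of "1 - f"] assms by simp

lemma mps_mult_cancel:
  fixes f g h :: "('v, 'a::comm_ring_1) mps"
  assumes "mps_nth f {#} = 1" "g * f = h * f"
  shows "g = h"
proof -
  have "g * (f * inverse f) = h * (f * inverse f)" using assms(2) by (simp flip: mult.assoc)
  then show ?thesis by (simp add: mps_mult_inverse[OF assms(1)])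
qed

lemma mps_divide_mult_cancel:
  fixes f g :: "('v, 'a::comm_ring_1) mps"
  assumes "mps_nth f {#} = 1"
  shows "g / f * f = g"
proof -
  have "g / f * f = g * (f * inverse f)" by (simp add: divide_mps_def mult_ac)
  then show ?thesis by (simp add: mps_mult_inverse[OF assms])
qed

lemma mps_divide_eq:
  fixes f g h :: "('v, 'a::comm_ring_1) mps"
  assumes "mps_nth f {#} = 1" "g = h * f"
  shows "g / f = h"
  using mps_mult_inverse[OF assms(1)] by (simp add: divide_mps_def assms(2) mult.assoc)

lemma mps_subst_divide:
  fixes z :: "'v \<Rightarrow> ('w, 'a::comm_ring_1) mps"
  assumes z: "null_family z" and "mps_nth f {#} = 1"
  shows "mps_subst z (g / f) = mps_subst z g / mps_subst z f"
proof -
  have "mps_subst z f * mps_subst z (inverse f) = 1"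
    using assms by (simp add: mps_mult_inverse mps_subst_null_simps flip: mps_subst_null_simps(1))
  then show ?thesis
    by (simp add: divide_mps_def mps_subst_null_simps(1)[OF z] mps_inverse_unique)
qed

lemma mps_nth_var_mult:
  "mps_nth (mps_var i * f) m = (if i \<in># m then mps_nth f (m - {#i#}) else 0)"
  for f :: "('v, 'a::comm_ring_1) mps"
proof -
  have "mps_nth (mps_var i * f) m =
    (\<Sum>a | a \<subseteq># m. if a = {#i#} then mps_nth f (m - {#i#}) else 0)"
    unfolding mps_nth_mult by (rule sum.cong) auto
  then show ?thesis by (simp add: finite_submultisets single_subset_iff)
qed

lemma mps_nth_var_power:
  "mps_nth (mps_var i ^ n :: ('v, 'a::comm_ring_1) mps) m = (if m = replicate_mset n i then 1 else 0)"
  by (induction n arbitrary: m) (auto simp: mps_nth_var_mult dest: insert_DiffM)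

section \<open>The exponential of an odd family of power sums\<close>

text \<open>The weights divide by the integers \<open>z_part \<mu>\<close>, so characteristic zero
  is required of the field of rational functions in \<open>beta\<close>.\<close>

instance fract :: ("{idom, ring_char_0}") field_char_0
proof
  have "of_nat n = to_fract (of_nat n :: 'a)" for n
    by (induction n) simp_all
  then show "inj (of_nat :: nat \<Rightarrow> 'a fract)" by (simp add: inj_def)
qed

lemma of_nat_mps_cancel:
  fixes f g :: "('v, 'a::field_char_0) mps"
  assumes "of_nat n * f = of_nat n * g" "n \<noteq> 0"
  shows "f = g"
proof (rule mps_eqI)
  fix m
  have "mps_nth (mps_const (of_nat n) * f) m = mps_nth (mps_const (of_nat n) * g) m"
    using assms(1) by (simp add: mps_const_of_nat)
  with assms(2) show "mps_nth f m = mps_nth g m" by simp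
qed

text \<open>Only the factor at \<open>k\<close> changes: its power gains one \<open>k\<close> and
  its factorial gains the new multiplicity. All recursions for the weights rest on this.\<close>

lemma z_part_add_mset: "z_part (add_mset k \<nu>) = k * Suc (count \<nu> k) * z_part \<nu>"
proof -
  let ?S = "insert k (set_mset \<nu>)"
  have S: "z_part \<mu> = (\<Prod>i\<in>?S. i ^ count \<mu> i * fact (count \<mu> i))" if "set_mset \<mu> \<subseteq> ?S" for \<mu>
    unfolding z_part_def by (rule prod.mono_neutral_left) (use that in \<open>auto simp: not_in_iff\<close>)
  let ?P = "\<Prod>i\<in>?S - {k}. i ^ count \<nu> i * fact (count \<nu> i)"
  have "z_part (add_mset k \<nu>) = k ^ Suc (count \<nu> k) * fact (Suc (count \<nu> k)) * ?P"
    by (subst S) (simp_all add: prod.remove[of ?S k])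
  moreover have "z_part \<nu> = k ^ count \<nu> k * fact (count \<nu> k) * ?P"
    by (subst S) (auto simp: prod.remove[of ?S k])
  ultimately show ?thesis by (simp only: power_Suc fact_Suc of_nat_id mult_ac)
qed

lemma z_part_nonzero: "\<mu> \<in> OP \<Longrightarrow> z_part \<mu> \<noteq> 0"
  by (auto simp: z_part_def OP_def)

text \<open>Extension by zero off \<open>OP\<close> lets the exponential be a sum over all
  multisets, where convolution is available.\<close>

definition weight :: "nat multiset \<Rightarrow> 'a::field_char_0" where
  "weight \<mu> = (if \<mu> \<in> OP then 2 ^ size \<mu> / of_nat (z_part \<mu>) else 0)"

text \<open>Coefficient form of the differential equation of the exponential: for
  \<open>E = exp (\<Sum> 2 q_n / n)\<close> over odd \<open>n\<close>, the derivative with respect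
  to \<open>q_k\<close> is \<open>2 / k * E\<close> if \<open>k\<close> is odd and 0
  otherwise.\<close>

lemma weight_add_mset:
  "of_nat (k * Suc (count \<nu> k)) * weight (add_mset k \<nu>) =
    (if odd k then 2 else 0) * (weight \<nu> :: 'a::field_char_0)"
proof (cases "add_mset k \<nu> \<in> OP")
  case True
  then have "odd k" "\<nu> \<in> OP" by (auto simp: OP_def)
  define A :: 'a where "A = of_nat (k * Suc (count \<nu> k))"
  have "A \<noteq> 0"
    using \<open>odd k\<close> unfolding A_def of_nat_eq_0_iff by (auto intro: odd_pos)
  moreover have "weight (add_mset k \<nu>) = 2 * 2 ^ size \<nu> / (A * of_nat (z_part \<nu>))"
    using True by (simp only: weight_def z_part_add_mset of_nat_mult[of "_ * _" "z_part \<nu>"] A_def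
        if_True size_add_mset power_Suc)
  ultimately have "A * weight (add_mset k \<nu>) = 2 * weight \<nu>"
    using \<open>\<nu> \<in> OP\<close> by (simp add: weight_def[of \<nu>])
  with \<open>odd k\<close> show ?thesis unfolding A_def by simp
qed (auto simp: weight_def OP_def)

text \<open>The series \<open>\<Sum>\<^sub>\<mu> 2\<^sup>\<ell>\<^sup>(\<^sup>\<mu>\<^sup>) z\<^sub>\<mu>\<^sup>-\<^sup>1 q\<^sub>\<mu> = exp (\<Sum>\<^sub>n 2 q\<^sub>n / n)\<close>, \<open>\<mu>\<close> in \<^const>\<open>OP\<close> and \<open>n\<close> odd.\<close>

definition odd_exp :: "(nat \<Rightarrow> ('v, 'a::field_char_0) mps) \<Rightarrow> ('v, 'a) mps" where
  "odd_exp q = mps_subst q (Abs_mps weight)"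

definition odd_exp_term :: "(nat \<Rightarrow> ('v, 'a::field_char_0) mps) \<Rightarrow> nat multiset \<Rightarrow> ('v, 'a) mps" where
  "odd_exp_term q \<mu> = mps_const (weight \<mu>) * (\<Prod>i\<in>#\<mu>. q i)"

lemma odd_exp_has_sum: "null_family q \<Longrightarrow> (odd_exp_term q has_sum odd_exp q) UNIV"
  using has_subst_null[of q "Abs_mps weight"]
  unfolding has_subst_def odd_exp_def odd_exp_term_def[abs_def] by simp

lemma odd_exp_eqI: "(odd_exp_term q has_sum F) UNIV \<Longrightarrow> odd_exp q = F"
  using has_subst_imp_eq[of q "Abs_mps weight" F]
  unfolding has_subst_def odd_exp_def odd_exp_term_def[abs_def] by simp

lemma odd_exp_term_add_mset:
  "of_nat (k * Suc (count \<nu> k)) * odd_exp_term q (add_mset k \<nu>) =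
    mps_const (if odd k then 2 else 0) * q k * odd_exp_term q \<nu>"
proof -
  have "of_nat (k * Suc (count \<nu> k)) * odd_exp_term q (add_mset k \<nu>) =
    mps_const (of_nat (k * Suc (count \<nu> k)) * weight (add_mset k \<nu>)) * (\<Prod>i\<in>#add_mset k \<nu>. q i)"
    unfolding mps_const_mult mps_const_of_nat odd_exp_term_def by (simp only: mult.assoc)
  then show ?thesis
    unfolding weight_add_mset mps_const_mult odd_exp_term_def
    by (simp only: image_mset_add_mset prod_mset.add_mset mult_ac)
qed

text \<open>One half of the product rule, in coefficients. Weighting by \<open>count \<nu> x\<close>
  acts like the Euler operator of the variable \<open>x\<close> on the factor \<open>F\<close>;
  terms without \<open>x\<close> drop out, and the others lose one copy of \<open>x\<close> by the
  hypothesis on \<open>F\<close>.\<close>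

lemma convolution_count:
  fixes F H :: "'i multiset \<Rightarrow> 'b::comm_ring_1"
  assumes "\<And>\<nu>. of_nat (k * Suc (count \<nu> x)) * F (add_mset x \<nu>) = c * F \<nu>"
  shows "(\<Sum>\<nu> | \<nu> \<subseteq># add_mset x \<mu>. of_nat (k * count \<nu> x) * (F \<nu> * H (add_mset x \<mu> - \<nu>))) =
    c * (\<Sum>\<nu> | \<nu> \<subseteq># \<mu>. F \<nu> * H (\<mu> - \<nu>))"
proof -
  have "(\<Sum>\<nu> | \<nu> \<subseteq># add_mset x \<mu>. of_nat (k * count \<nu> x) * (F \<nu> * H (add_mset x \<mu> - \<nu>))) =
    (\<Sum>\<nu> | \<nu> \<subseteq># add_mset x \<mu> \<and> x \<in># \<nu>. of_nat (k * count \<nu> x) * (F \<nu> * H (add_mset x \<mu> - \<nu>)))"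
    by (rule sum.mono_neutral_right) (auto simp: finite_submultisets not_in_iff)
  also have "\<dots> = (\<Sum>\<nu> | \<nu> \<subseteq># \<mu>. c * (F \<nu> * H (\<mu> - \<nu>)))"
  proof (rule sum.reindex_bij_witness[of _ "add_mset x" "\<lambda>\<nu>. \<nu> - {#x#}"])
    fix \<nu> assume "\<nu> \<in> {\<nu>. \<nu> \<subseteq># add_mset x \<mu> \<and> x \<in># \<nu>}"
    then obtain \<kappa> where \<kappa>: "\<nu> = add_mset x \<kappa>" by (auto dest: multi_member_split)
    have "of_nat (k * count \<nu> x) * F \<nu> = c * F \<kappa>"
      using assms[of \<kappa>] by (simp add: \<kappa>)
    then show "c * (F (\<nu> - {#x#}) * H (\<mu> - (\<nu> - {#x#}))) =
      of_nat (k * count \<nu> x) * (F \<nu> * H (add_mset x \<mu> - \<nu>))"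
      by (simp add: \<kappa> flip: mult.assoc)
  qed (auto simp: subset_eq_diff_conv)
  finally show ?thesis by (simp add: sum_distrib_left)
qed

lemma sum_submultisets_swap:
  "(\<Sum>\<nu> | \<nu> \<subseteq># \<mu>. h \<nu> (\<mu> - \<nu>)) = (\<Sum>\<nu> | \<nu> \<subseteq># \<mu>. h (\<mu> - \<nu>) \<nu>)"
  by (rule sum.reindex_bij_witness[of _ "\<lambda>a. \<mu> - a" "\<lambda>a. \<mu> - a"]) (auto simp: double_diff_submultiset)

text \<open>The law \<open>exp (q + q') = exp q * exp q'\<close>, proved term by term and hence
  without any convergence. Both sides satisfy the same first-order recursion in the part
  \<open>k\<close>. Off \<open>OP\<close>, an even part must lie in one of the two pieces, so every
  summand vanishes.\<close>

lemma odd_exp_term_add: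
  "(\<Sum>\<nu> | \<nu> \<subseteq># \<mu>. odd_exp_term q \<nu> * odd_exp_term q' (\<mu> - \<nu>)) = odd_exp_term (\<lambda>n. q n + q' n) \<mu>"
proof (induction \<mu>)
  case empty
  show ?case by (simp add: odd_exp_term_def weight_def OP_def z_part_def)
next
  case (add k \<mu>)
  show ?case
  proof (cases "add_mset k \<mu> \<in> OP")
    case True
    \<comment> \<open>The multiplicity of \<open>k\<close> in the enlarged multiset splits between
      \<open>\<nu>\<close> and its complement, so multiplying by \<open>N\<close> produces the two
      halves of the product rule; \<open>N\<close> is cancelled at the end.\<close>
    define N where "N = k * Suc (count \<mu> k)"
    have N: "N \<noteq> 0" using True by (auto simp: N_def OP_def intro: odd_pos)
    let ?c = "mps_const (if odd k then 2 else 0) :: ('a, 'b) mps"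
    let ?S = "\<lambda>\<mu>. \<Sum>\<nu> | \<nu> \<subseteq># \<mu>. odd_exp_term q \<nu> * odd_exp_term q' (\<mu> - \<nu>)"
    have "of_nat N * ?S (add_mset k \<mu>) =
      (\<Sum>\<nu> | \<nu> \<subseteq># add_mset k \<mu>. of_nat (k * count \<nu> k) *
        (odd_exp_term q \<nu> * odd_exp_term q' (add_mset k \<mu> - \<nu>))) +
      (\<Sum>\<nu> | \<nu> \<subseteq># add_mset k \<mu>. of_nat (k * count (add_mset k \<mu> - \<nu>) k) *
        (odd_exp_term q' (add_mset k \<mu> - \<nu>) * odd_exp_term q \<nu>))"
      unfolding sum_distrib_left sum.distrib[symmetric]
    proof (rule sum.cong[OF refl])
      fix \<nu> assume "\<nu> \<in> {\<nu>. \<nu> \<subseteq># add_mset k \<mu>}"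
      then have "count \<nu> k + count (add_mset k \<mu> - \<nu>) k = count (add_mset k \<mu>) k"
        by (metis count_union mem_Collect_eq subset_mset.add_diff_inverse)
      then have N: "N = k * count \<nu> k + k * count (add_mset k \<mu> - \<nu>) k"
        by (simp add: N_def flip: distrib_left)
      show "of_nat N * (odd_exp_term q \<nu> * odd_exp_term q' (add_mset k \<mu> - \<nu>)) =
        of_nat (k * count \<nu> k) * (odd_exp_term q \<nu> * odd_exp_term q' (add_mset k \<mu> - \<nu>)) +
        of_nat (k * count (add_mset k \<mu> - \<nu>) k) * (odd_exp_term q' (add_mset k \<mu> - \<nu>) * odd_exp_term q \<nu>)"
        unfolding N of_nat_add by (simp only: distrib_right mult.commute[of "odd_exp_term q' _" "odd_exp_term q _"])
    qed
    also have "\<dots> = ?c * q k * ?S \<mu> + ?c * q' k * ?S \<mu>"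
      using convolution_count[where F = "odd_exp_term q" and c = "?c * q k" and H = "odd_exp_term q'"
            and k = k and x = k and \<mu> = \<mu>]
        convolution_count[where F = "odd_exp_term q'" and c = "?c * q' k" and H = "odd_exp_term q"
            and k = k and x = k and \<mu> = \<mu>]
      by (simp only: odd_exp_term_add_mset mult.commute[of "odd_exp_term q' _" "odd_exp_term q _"]
        sum_submultisets_swap[of "\<lambda>a b. of_nat (k * count b k) * (odd_exp_term q a * odd_exp_term q' b)" "add_mset k \<mu>"]
        sum_submultisets_swap[of "\<lambda>a b. odd_exp_term q a * odd_exp_term q' b" \<mu>])
    also have "\<dots> = of_nat N * odd_exp_term (\<lambda>n. q n + q' n) (add_mset k \<mu>)"
      unfolding add.IH N_def odd_exp_term_add_mset by (simp only: distrib_right distrib_left)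
    finally show ?thesis using N by (rule of_nat_mps_cancel)
  next
    case False
    have "odd_exp_term q \<nu> * odd_exp_term q' (add_mset k \<mu> - \<nu>) = 0" if "\<nu> \<subseteq># add_mset k \<mu>" for \<nu>
    proof -
      have "\<nu> + (add_mset k \<mu> - \<nu>) \<notin> OP"
        by (simp add: subset_mset.add_diff_inverse[OF that] False)
      then have "\<nu> \<notin> OP \<or> add_mset k \<mu> - \<nu> \<notin> OP" unfolding OP_def by auto
      then show ?thesis by (auto simp: odd_exp_term_def weight_def)
    qed
    with False show ?thesis by (simp add: odd_exp_term_def weight_def)
  qed
qed

lemma odd_exp_add:
  assumes "null_family q" "null_family q'"
  shows "odd_exp (\<lambda>n. q n + q' n) = odd_exp q * odd_exp q'"
  using has_sum_mps_convolution[OF odd_exp_has_sum[OF assms(1)] odd_exp_has_sum[OF assms(2)]]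
  by (intro odd_exp_eqI) (simp add: odd_exp_term_add)

lemma null_family_sum:
  fixes q :: "'p \<Rightarrow> 'v \<Rightarrow> ('w, 'a::comm_ring_1) mps"
  assumes "finite A" "\<And>p. p \<in> A \<Longrightarrow> null_family (q p)"
  shows "null_family (\<lambda>i. \<Sum>p\<in>A. q p i)"
proof -
  have "finite {i. (\<Sum>p\<in>A. mps_nth (q p i) m) \<noteq> 0}" for m
  proof (rule finite_subset)
    show "{i. (\<Sum>p\<in>A. mps_nth (q p i) m) \<noteq> 0} \<subseteq> (\<Union>p\<in>A. {i. mps_nth (q p i) m \<noteq> 0})"
      by (auto intro: sum.neutral)
    show "finite (\<Union>p\<in>A. {i. mps_nth (q p i) m \<noteq> 0})"
      using assms by (auto simp: null_family_def locally_finite_def)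
  qed
  with assms show ?thesis by (simp add: null_family_def locally_finite_def)
qed

lemma odd_exp_sum:
  fixes q :: "'p \<Rightarrow> nat \<Rightarrow> ('w, 'a::field_char_0) mps"
  assumes "finite A" "\<And>p. p \<in> A \<Longrightarrow> null_family (q p)"
  shows "odd_exp (\<lambda>n. \<Sum>p\<in>A. q p n) = (\<Prod>p\<in>A. odd_exp (q p))"
  using assms
proof (induction A rule: finite_induct)
  case empty
  have "odd_exp_term (\<lambda>n. 0 :: ('w, 'a) mps) \<mu> = 0" if "\<mu> \<noteq> {#}" for \<mu>
    using that by (cases \<mu>) (auto simp: odd_exp_term_def)
  then have "(odd_exp_term (\<lambda>n. 0 :: ('w, 'a) mps) has_sum 1) UNIV"
    by (intro has_sum_single[of _ "{#}"])
      (auto simp: odd_exp_term_def weight_def OP_def z_part_def)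
  then show ?case by (simp add: odd_exp_eqI)
next
  case (insert p A)
  then show ?case by (simp add: odd_exp_add null_family_sum)
qed

section \<open>Infinite products of exponentials\<close>

lemma mps_nth_subst_cong:
  fixes z z' :: "'v \<Rightarrow> ('w, 'a::comm_ring_1) mps"
  assumes "null_family z" "null_family z'" and eq: "\<And>i b. b \<subseteq># m \<Longrightarrow> mps_nth (z i) b = mps_nth (z' i) b"
  shows "mps_nth (mps_subst z f) m = mps_nth (mps_subst z' f) m"
proof -
  have "relevant z m = relevant z' m"
    unfolding relevant_def using eq by metis
  then have "subst_support z m = subst_support z' m"
    by (simp add: subst_support_def)
  then show ?thesis
    unfolding mps_nth_subst[OF assms(1)] mps_nth_subst[OF assms(2)]
    by (intro sum.cong arg_cong2[where f = "(*)"] mps_nth_prod_mset_cong) (auto simp: eq)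
qed

text \<open>The finiteness in \<open>fin\<close> is uniform in \<open>n\<close>. Beyond a finite set
  of indices the partial sums agree with \<open>Q n\<close> at all divisors of \<open>m\<close> for
  every \<open>n\<close> at once, and locality of substitution carries this over to the
  exponentials, where finite sums become finite products.\<close>

lemma has_uprod_odd_exp:
  fixes q :: "'p \<Rightarrow> nat \<Rightarrow> ('w, 'a::field_char_0) mps"
  assumes q: "\<And>p. p \<in> A \<Longrightarrow> null_family (q p)" and Q: "null_family Q"
    and sum: "\<And>n. ((\<lambda>p. q p n) has_sum Q n) A"
    and fin: "\<And>m. finite {p\<in>A. \<exists>n. mps_nth (q p n) m \<noteq> 0}"
  shows "has_uprod (\<lambda>p. odd_exp (q p)) (odd_exp Q) A"
  unfolding has_uprod_def tendsto_mps_iff eventually_finite_subsets_at_top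
proof (rule allI)
  fix m
  define X where "X = (\<Union>b\<in>{b. b \<subseteq># m}. {p\<in>A. \<exists>n. mps_nth (q p n) b \<noteq> 0})"
  have X: "finite X" "X \<subseteq> A" unfolding X_def using fin by (auto simp: finite_submultisets)
  have "mps_nth (\<Prod>p\<in>Y. odd_exp (q p)) m = mps_nth (odd_exp Q) m"
    if Y: "finite Y" "X \<subseteq> Y" "Y \<subseteq> A" for Y
  proof -
    have null: "null_family (\<lambda>n. \<Sum>p\<in>Y. q p n)"
      using Y q by (intro null_family_sum) auto
    have "mps_nth (\<Sum>p\<in>Y. q p n) b = mps_nth (Q n) b" if "b \<subseteq># m" for n b
      using has_sum_mps_nth[OF sum[of n] Y(1), of b] Y that unfolding X_def by fastforce
    then have "mps_nth (odd_exp (\<lambda>n. \<Sum>p\<in>Y. q p n)) m = mps_nth (odd_exp Q) m"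
      unfolding odd_exp_def by (intro mps_nth_subst_cong null Q)
    with Y q show ?thesis by (subst (asm) odd_exp_sum) auto
  qed
  with X show "\<exists>X. finite X \<and> X \<subseteq> A \<and> (\<forall>Y. finite Y \<and> X \<subseteq> Y \<and> Y \<subseteq> A \<longrightarrow>
    mps_nth (\<Prod>p\<in>Y. odd_exp (q p)) m = mps_nth (odd_exp Q) m)"
    by (intro exI[of _ X]) simp
qed

section \<open>The exponential at the powers of one series\<close>

definition OP_of :: "nat \<Rightarrow> nat multiset set" where
  "OP_of n = {\<mu> \<in> OP. sum_mset \<mu> = n}"

lemma size_le_sum_mset: "0 \<notin># \<mu> \<Longrightarrow> size \<mu> \<le> sum_mset \<mu>" for \<mu> :: "nat multiset"
  by (induction \<mu>) auto

lemma elem_le_sum_mset: "k \<in># \<mu> \<Longrightarrow> k \<le> sum_mset \<mu>" for \<mu> :: "nat multiset"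
  by (induction \<mu>) auto

lemma sum_mult_count:
  fixes \<mu> :: "nat multiset"
  assumes "finite A" "set_mset \<mu> \<subseteq> A"
  shows "(\<Sum>k\<in>A. k * count \<mu> k) = sum_mset \<mu>"
  using assms(2)
proof (induction \<mu>)
  case (add x \<mu>)
  have "(\<Sum>k\<in>A. k * count (add_mset x \<mu>) k) = (\<Sum>k\<in>A. (if k = x then x else 0) + k * count \<mu> k)"
    by (intro sum.cong) auto
  with add assms(1) show ?case by (simp add: sum.distrib)
qed simp

lemma finite_OP_of: "finite (OP_of n)"
proof (rule finite_subset[OF _ finite_multisets_bounded[of "{..n}" n]])
  show "OP_of n \<subseteq> {a. set_mset a \<subseteq> {..n} \<and> size a \<le> n}"
  proof (intro subsetI CollectI conjI)
    fix \<mu> k assume \<mu>: "\<mu> \<in> OP_of n"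
    then show "size \<mu> \<le> n" using size_le_sum_mset[of \<mu>] by (auto simp: OP_of_def OP_def)
    show "k \<in> {..n}" if "k \<in># \<mu>" using elem_le_sum_mset[OF that] \<mu> by (simp add: OP_of_def)
  qed
qed simp

text \<open>With \<open>E\<close> the generating function of the left-hand sums, this is
  \<open>t E' = 2 (t + t^3 + t^5 + ...) E\<close>, the equation satisfied by
  \<open>(1 + t) / (1 - t)\<close>. It arises by writing \<open>n\<close> as the sum of
  \<open>k * count \<mu> k\<close> and removing one part \<open>k\<close>.\<close>

lemma sum_weight_OP_of_rec:
  "of_nat n * (\<Sum>\<mu>\<in>OP_of n. weight \<mu>) =
    (\<Sum>k\<le>n. if odd k then 2 * (\<Sum>\<mu>\<in>OP_of (n - k). weight \<mu>) else (0 :: 'a::field_char_0))"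
proof -
  have sum_count: "(\<Sum>k\<le>n. of_nat (k * count \<mu> k)) = (of_nat n :: 'a)" if "\<mu> \<in> OP_of n" for \<mu>
  proof -
    have "set_mset \<mu> \<subseteq> {..n}"
    proof
      fix k assume "k \<in># \<mu>"
      then show "k \<in> {..n}" using elem_le_sum_mset[of k \<mu>] that by (simp add: OP_of_def)
    qed
    then have "(\<Sum>k\<le>n. k * count \<mu> k) = n"
      using that by (simp add: sum_mult_count OP_of_def)
    then show ?thesis by (metis of_nat_sum)
  qed
  have step: "(\<Sum>\<mu>\<in>OP_of n. of_nat (k * count \<mu> k) * weight \<mu>) =
      (if odd k then 2 * (\<Sum>\<mu>\<in>OP_of (n - k). weight \<mu>) else (0 :: 'a))" if "k \<le> n" for k
  proof (cases "odd k")
    case True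
    have "(\<Sum>\<mu>\<in>OP_of n. of_nat (k * count \<mu> k) * weight \<mu>) =
      (\<Sum>\<mu>\<in>{\<mu>\<in>OP_of n. k \<in># \<mu>}. of_nat (k * count \<mu> k) * (weight \<mu> :: 'a))"
      by (rule sum.mono_neutral_right) (auto simp: finite_OP_of not_in_iff)
    also have "\<dots> = (\<Sum>\<mu>\<in>OP_of (n - k). 2 * weight \<mu>)"
    proof (rule sum.reindex_bij_witness[of _ "add_mset k" "\<lambda>\<nu>. \<nu> - {#k#}"])
      fix \<mu> assume \<mu>: "\<mu> \<in> {\<mu>\<in>OP_of n. k \<in># \<mu>}"
      then obtain \<kappa> where \<kappa>: "\<mu> = add_mset k \<kappa>" using multi_member_split[of k \<mu>] by blast
      show "\<mu> - {#k#} \<in> OP_of (n - k)" using \<mu> unfolding \<kappa> OP_of_def OP_def by simp linarith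
      show "2 * weight (\<mu> - {#k#}) = of_nat (k * count \<mu> k) * (weight \<mu> :: 'a)"
        using weight_add_mset[of k \<kappa>, where 'a = 'a] True by (simp add: \<kappa>)
    qed (use that True in \<open>simp_all add: OP_of_def OP_def\<close>)
    finally show ?thesis using True by (simp add: sum_distrib_left)
  next
    case False
    then have "count \<mu> k = 0" if "\<mu> \<in> OP_of n" for \<mu>
      using that by (auto simp: OP_of_def OP_def not_in_iff[symmetric])
    with False show ?thesis by simp
  qed
  have "of_nat n * (\<Sum>\<mu>\<in>OP_of n. weight \<mu>) =
    (\<Sum>\<mu>\<in>OP_of n. \<Sum>k\<le>n. of_nat (k * count \<mu> k) * (weight \<mu> :: 'a))"
    unfolding sum_distrib_left sum_distrib_right[symmetric] by (intro sum.cong refl) (simp only: sum_count)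
  also have "\<dots> = (\<Sum>k\<le>n. \<Sum>\<mu>\<in>OP_of n. of_nat (k * count \<mu> k) * weight \<mu>)"
    by (rule sum.swap)
  also have "\<dots> = (\<Sum>k\<le>n. if odd k then 2 * (\<Sum>\<mu>\<in>OP_of (n - k). weight \<mu>) else 0)"
    by (rule sum.cong[OF refl], rule step) simp
  finally show ?thesis .
qed

lemma sum_weight_OP_of:
  "(\<Sum>\<mu>\<in>OP_of n. weight \<mu>) = (if n = 0 then 1 else 2 :: 'a::field_char_0)"
proof (induction n rule: less_induct)
  case (less n)
  let ?e = "\<lambda>n. if n = 0 then 1 else 2 :: 'a"
  \<comment> \<open>Each odd \<open>k < n\<close> contributes 2, and \<open>k = n\<close>
    contributes 1 when \<open>n\<close> is odd; the total is \<open>n\<close> in either parity.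
    Shifting by two adds one odd index with value 2.\<close>
  have e: "(\<Sum>k\<le>n. if odd k then ?e (n - k) else 0) = of_nat n" for n
  proof (induction n rule: induct_nat_012)
    case (ge2 n)
    have "(\<Sum>k\<le>Suc (Suc n). if odd k then ?e (Suc (Suc n) - k) else 0) =
      2 + (\<Sum>k\<le>n. if odd k then ?e (n - k) else 0)"
      unfolding sum.atMost_Suc_shift diff_Suc_Suc by simp
    with ge2(1) show ?case by simp
  qed simp_all
  show ?case
  proof (cases "n = 0")
    case True
    have "\<mu> = {#}" if "\<mu> \<in> OP_of 0" for \<mu>
    proof -
      have "0 \<notin># \<mu>" "sum_mset \<mu> = 0" using that by (auto simp: OP_of_def OP_def simp del: sum_mset_0_iff)
      with size_le_sum_mset[of \<mu>] show ?thesis by (simp del: sum_mset_0_iff)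
    qed
    then have "OP_of 0 = {{#}}" by (auto simp: OP_of_def OP_def)
    then show ?thesis by (simp add: True weight_def OP_def z_part_def)
  next
    case False
    have "of_nat n * (\<Sum>\<mu>\<in>OP_of n. weight \<mu>) = (\<Sum>k\<le>n. 2 * (if odd k then ?e (n - k) else 0))"
      unfolding sum_weight_OP_of_rec using False less.IH
      by (intro sum.cong) (auto simp: odd_pos)
    also have "\<dots> = of_nat n * 2"
      unfolding sum_distrib_left[symmetric] e by simp
    finally show ?thesis using False by simp
  qed
qed

text \<open>The value at 0 is 0 rather than \<open>a ^ 0 = 1\<close>, which would have a constant
  term; odd partitions have no part 0, so the exponential is that of the true powers.\<close>

definition powers :: "('v, 'a::comm_ring_1) mps \<Rightarrow> nat \<Rightarrow> ('v, 'a) mps" where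
  "powers a n = (if n = 0 then 0 else a ^ n)"

lemma null_family_powers: "mps_nth a {#} = 0 \<Longrightarrow> null_family (powers a)"
  for a :: "('v, 'a::comm_ring_1) mps"
proof -
  assume a: "mps_nth a {#} = 0"
  have fin: "{n. mps_nth (powers a n) m \<noteq> 0} \<subseteq> {..size m}" for m
  proof
    fix n assume "n \<in> {n. mps_nth (powers a n) m \<noteq> 0}"
    then have "mps_nth (a ^ n) m \<noteq> 0" by (simp add: powers_def split: if_splits)
    then have "\<not> size m < n" using mps_nth_power_eq_0[OF a] by blast
    then show "n \<in> {..size m}" by simp
  qed
  then have "locally_finite (powers a)"
    unfolding locally_finite_def using finite_subset[OF fin] by simp
  then show ?thesis
    using mps_nth_power_eq_0[OF a, of "{#}"] by (auto simp: null_family_def powers_def)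
qed

text \<open>On partitions of \<open>n\<close> the product of powers is \<open>a ^ n\<close>, so
  grouping by \<open>n\<close> leaves the series with coefficients 1, 2, 2, ..., which is
  \<open>2 / (1 - a) - 1\<close>.\<close>

lemma odd_exp_powers:
  fixes a :: "('v, 'a::field_char_0) mps"
  assumes a: "mps_nth a {#} = 0"
  shows "odd_exp (powers a) * (1 - a) = 1 + a"
proof -
  have term_eq: "odd_exp_term (powers a) \<mu> = mps_const (weight \<mu>) * a ^ n" if "\<mu> \<in> OP_of n" for \<mu> n
  proof -
    have "(\<Prod>i\<in>#\<mu>. powers a i) = a ^ sum_mset \<mu>" if "0 \<notin># \<mu>"
      using that by (induction \<mu>) (auto simp: powers_def power_add)
    moreover have "0 \<notin># \<mu>" "sum_mset \<mu> = n" using that unfolding OP_of_def OP_def by auto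
    ultimately show ?thesis by (simp add: odd_exp_term_def)
  qed
  have "(odd_exp_term (powers a) has_sum odd_exp (powers a)) OP"
    using odd_exp_has_sum[OF null_family_powers[OF a]]
    by (subst has_sum_cong_neutral[where T = UNIV and g = "odd_exp_term (powers a)"])
      (auto simp: odd_exp_term_def weight_def)
  also have "?this \<longleftrightarrow>
    ((\<lambda>(n, \<mu>). odd_exp_term (powers a) \<mu>) has_sum odd_exp (powers a)) (SIGMA n:UNIV. OP_of n)"
    by (rule has_sum_reindex_bij_witness[of _ snd "\<lambda>\<mu>. (sum_mset \<mu>, \<mu>)"]) (auto simp: OP_of_def)
  finally have "((\<lambda>n. \<Sum>\<mu>\<in>OP_of n. odd_exp_term (powers a) \<mu>) has_sum odd_exp (powers a)) UNIV"
    using has_sum_mps_fibers[of "\<lambda>(n, \<mu>). odd_exp_term (powers a) \<mu>" UNIV OP_of]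
    by (simp add: finite_OP_of)
  moreover have "(\<Sum>\<mu>\<in>OP_of n. odd_exp_term (powers a) \<mu>) = 2 * a ^ n - (if n = 0 then 1 else 0)" for n
  proof -
    have "(\<Sum>\<mu>\<in>OP_of n. odd_exp_term (powers a) \<mu>) = mps_const (\<Sum>\<mu>\<in>OP_of n. weight \<mu>) * a ^ n"
      by (rule mps_eqI) (simp add: term_eq sum_distrib_right)
    then show ?thesis
      unfolding sum_weight_OP_of using mps_const_of_nat[of 2, where 'a = 'a and 'v = 'v] by simp
  qed
  ultimately have "((\<lambda>n. 2 * a ^ n - (if n = 0 then 1 else 0)) has_sum odd_exp (powers a)) UNIV"
    by simp
  note sum1 = infsumI[OF this]
  have "((\<lambda>n. 2 * a ^ n - (if n = 0 then 1 else 0)) has_sum 2 * inverse (1 - a) - 1) UNIV"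
    by (intro has_sum_mps_diff has_sum_mps_cmult geometric_mps(2)[OF a]) (rule has_sum_single[of _ 0]; simp)
  note sum2 = infsumI[OF this]
  have "odd_exp (powers a) = 2 * inverse (1 - a) - 1"
    using sum1 sum2 by (rule box_equals[OF refl])
  then have "odd_exp (powers a) * (1 - a) = 2 * ((1 - a) * inverse (1 - a)) - (1 - a)"
    by (simp only: left_diff_distrib mult_1_left mult.assoc mult.commute[of "inverse _"])
  also have "\<dots> = 1 + a" by (simp add: geometric_mps(1)[OF a])
  finally show ?thesis .
qed

section \<open>Power sums\<close>

lemma psum_has_sum:
  fixes z :: "nat \<Rightarrow> ('v, qbeta) mps"
  assumes "locally_finite z" "n > 0"
  shows "((\<lambda>i. z i ^ n) has_sum psum n z) UNIV"
  unfolding psum_def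
proof (rule has_sum_infsum, rule summable_on_mpsI)
  fix m
  have "i \<in> relevant z m" if "mps_nth (z i ^ n) m \<noteq> 0" for i
    using mps_nth_prod_mset_nonzero_relevant[of z "replicate_mset n i" m] that assms(2) by simp
  then show "finite {i \<in> UNIV. mps_nth (z i ^ n) m \<noteq> 0}"
    by (intro finite_subset[OF _ finite_relevant[OF assms(1), of m]]) auto
qed

definition round_var :: "('v, qbeta) mps \<Rightarrow> ('v, qbeta) mps" where
  "round_var u = u / (1 + mps_const (beta / 2) * u)"

lemma round_var_mult: "mps_nth u {#} = 0 \<Longrightarrow> round_var u * (1 + mps_const (beta / 2) * u) = u"
  unfolding round_var_def by (rule mps_divide_mult_cancel) simp

lemma mps_nth_round_var_nonzeroE:
  assumes "mps_nth (round_var u) m \<noteq> 0"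
  obtains b where "b \<subseteq># m" "mps_nth u b \<noteq> 0"
  using assms unfolding round_var_def divide_mps_def by (blast elim: mps_nth_mult_nonzeroE)

lemma null_family_round_var:
  assumes "null_family z"
  shows "null_family (\<lambda>i. round_var (z i))"
proof -
  have "{i. mps_nth (round_var (z i)) m \<noteq> 0} \<subseteq> relevant z m" for m
    unfolding relevant_def by (blast elim: mps_nth_round_var_nonzeroE)
  with assms have "locally_finite (\<lambda>i. round_var (z i))"
    unfolding locally_finite_def null_family_def
    by (meson assms finite_relevant finite_subset locally_finite_def null_family_def)
  with assms show ?thesis
    by (simp add: null_family_def round_var_def divide_mps_def mps_nth_mult_empty)
qed

lemma psum_round_eq: "psum_round n z = psum n (\<lambda>i. round_var (z i))"
  by (simp add: psum_round_def round_var_def)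

lemma psum_round_has_sum:
  assumes "null_family z" "n > 0"
  shows "((\<lambda>i. round_var (z i) ^ n) has_sum psum_round n z) UNIV"
  unfolding psum_round_eq
  using null_family_round_var[OF assms(1)] by (intro psum_has_sum assms(2)) (simp add: null_family_def)

text \<open>Stopping before \<open>k = n\<close> removes exactly the constant \<open>c ^ n\<close>.
  This identifies the deformed power sum as a sum of centred powers that converges over infinitely
  many variables.\<close>

lemma binomial_lessThan:
  "(\<Sum>k<n. mps_const (of_nat (n choose k) * c ^ k) * z ^ (n - k)) = (z + mps_const c) ^ n - mps_const c ^ n"
  for z :: "('v, 'a::comm_ring_1) mps"
proof -
  have "(mps_const c + z) ^ n = (\<Sum>k\<le>n. of_nat (n choose k) * mps_const c ^ k * z ^ (n - k))"
    by (rule binomial_ring)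
  also have "\<dots> = (\<Sum>k<n. of_nat (n choose k) * mps_const c ^ k * z ^ (n - k)) + mps_const c ^ n"
    by (simp flip: lessThan_Suc_atMost)
  finally show ?thesis by (simp add: mps_const_mult mps_const_of_nat mps_const_power add.commute)
qed

lemma has_sum_mps_sum:
  fixes f :: "'j \<Rightarrow> 'i \<Rightarrow> ('v, 'a::comm_ring_1) mps"
  assumes "\<And>j. j \<in> J \<Longrightarrow> (f j has_sum F j) A"
  shows "((\<lambda>x. \<Sum>j\<in>J. f j x) has_sum (\<Sum>j\<in>J. F j)) A"
  using assms
proof (induction J rule: infinite_finite_induct)
  case (insert j J)
  then show ?case by (simp add: has_sum_mps_add)
qed (simp_all add: has_sum_0)

lemma psum_square_has_sum:
  assumes "locally_finite z"
  shows "((\<lambda>i. (z i + mps_const (beta / 2)) ^ n - mps_const (beta / 2) ^ n) has_sum psum_square n z) UNIV"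
proof -
  have "((\<lambda>i. \<Sum>k<n. mps_const (of_nat (n choose k) * (beta / 2) ^ k) * z i ^ (n - k)) has_sum
    (\<Sum>k<n. mps_const (of_nat (n choose k) * (beta / 2) ^ k) * psum (n - k) z)) UNIV"
    by (intro has_sum_mps_sum has_sum_mps_cmult psum_has_sum assms) auto
  then show ?thesis by (simp only: binomial_lessThan psum_square_def)
qed

section \<open>The Cauchy kernel\<close>

lemma null_family_var:
  assumes "inj f"
  shows "null_family (\<lambda>i. mps_var (f i) :: ('v, 'a::comm_ring_1) mps)"
proof -
  have "finite {i. mps_nth (mps_var (f i) :: ('v, 'a) mps) m \<noteq> 0}" for m
  proof (rule finite_subset)
    show "{i. mps_nth (mps_var (f i) :: ('v, 'a) mps) m \<noteq> 0} \<subseteq> f -` set_mset m" by auto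
  qed (simp add: finite_vimageI assms)
  then show ?thesis by (simp add: null_family_def locally_finite_def)
qed

lemma null_family_mps_var: "null_family (mps_var :: nat \<Rightarrow> series)"
  using null_family_var[of "\<lambda>i. i", where 'a = qbeta] by simp

lemma null_family_xv: "null_family xv" and null_family_yv: "null_family yv"
  unfolding xv_def[abs_def] yv_def[abs_def] by (simp_all add: null_family_var)

text \<open>The factored form can be summed over \<open>i\<close> and \<open>j\<close> separately;
  \<open>kernel_powers_eq\<close> turns it into a difference of two families of powers, the form
  suited to the exponential.\<close>

definition kernel_powers :: "nat \<times> nat \<Rightarrow> nat \<Rightarrow> (nat + nat, qbeta) mps" where
  "kernel_powers p n = round_var (xv (fst p)) ^ n *
    ((yv (snd p) + mps_const (beta / 2)) ^ n - mps_const (beta / 2) ^ n)"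

lemma kernel_powers_eq:
  "kernel_powers (i, j) n = powers (round_var (xv i) * (yv j + mps_const (beta / 2))) n -
    powers (round_var (xv i) * mps_const (beta / 2)) n"
  by (simp add: kernel_powers_def powers_def right_diff_distrib power_mult_distrib)

lemma mps_nth_round_xv_empty: "mps_nth (round_var (xv i)) {#} = 0"
  using null_family_round_var[OF null_family_xv] by (simp add: null_family_def)

lemma null_family_diff:
  fixes q q' :: "'v \<Rightarrow> ('w, 'a::comm_ring_1) mps"
  assumes "null_family q" "null_family q'"
  shows "null_family (\<lambda>n. q n - q' n)"
proof -
  have "{i. mps_nth (q i - q' i) m \<noteq> 0} \<subseteq> {i. mps_nth (q i) m \<noteq> 0} \<union> {i. mps_nth (q' i) m \<noteq> 0}" for m
    by auto
  from finite_subset[OF this] assms show ?thesis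
    unfolding null_family_def locally_finite_def by simp
qed

lemma null_family_kernel_powers: "null_family (kernel_powers p)"
proof -
  obtain i j where p: "p = (i, j)" by fastforce
  have eq: "kernel_powers p = (\<lambda>n. powers (round_var (xv i) * (yv j + mps_const (beta / 2))) n -
      powers (round_var (xv i) * mps_const (beta / 2)) n)"
    unfolding p by (rule ext) (rule kernel_powers_eq)
  show ?thesis
    unfolding eq
    by (intro null_family_diff null_family_powers)
      (simp_all add: mps_nth_mult_empty mps_nth_round_xv_empty)
qed

text \<open>Multiplicativity gives \<open>G * odd_exp (powers b) = odd_exp (powers a)\<close>, hence
  \<open>G (1 + b) (1 - a) = (1 + a) (1 - b)\<close>. From \<open>x (1 - b) = w\<close> and
  \<open>bar x (1 + b) = - w\<close> one gets \<open>(1 - x y) (1 - b) = 1 - a\<close> and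
  \<open>(1 - bar x y) (1 + b) = 1 + a\<close>, which identify \<open>G\<close>.\<close>

lemma odd_exp_kernel_powers:
  "odd_exp (kernel_powers (i, j)) = (1 - bar (xv i) * yv j) / (1 - xv i * yv j)"
proof -
  define c where "c = (mps_const (beta / 2) :: (nat + nat, qbeta) mps)"
  define x where "x = xv i"
  define y where "y = yv j"
  define w where "w = round_var x"
  define G where "G = odd_exp (kernel_powers (i, j))"
  have x0: "mps_nth x {#} = 0" and y0: "mps_nth y {#} = 0"
    using null_family_xv null_family_yv by (simp_all add: x_def y_def null_family_def)
  have w0: "mps_nth w {#} = 0" unfolding w_def x_def by (rule mps_nth_round_xv_empty)
  have cc: "mps_const beta = c + c" by (simp add: c_def flip: mps_const_hom(3))
  have w: "w * (1 + c * x) = x" unfolding w_def c_def by (rule round_var_mult[OF x0])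
  have bar: "bar x * (1 + (c + c) * x) = - x"
    unfolding bar_def cc by (rule mps_divide_mult_cancel) (simp add: mps_nth_mult_empty x0)
  have "(1 - w * c) * (1 + c * x) = 1 + c * x - c * (w * (1 + c * x))"
    by (simp add: algebra_simps)
  then have u: "(1 - w * c) * (1 + c * x) = 1" by (simp add: w)
  have "x * (1 - w * c) = w * ((1 - w * c) * (1 + c * x))"
    by (subst w[symmetric]) (simp only: mult_ac)
  then have x: "x * (1 - w * c) = w" by (simp add: u)
  have "(1 + w * c) * (1 + c * x) = 1 + c * x + c * (w * (1 + c * x))"
    by (simp add: algebra_simps)
  then have v: "(1 + w * c) * (1 + c * x) = 1 + (c + c) * x"
    unfolding w by (simp add: algebra_simps)
  \<comment> \<open>Multiplication by \<open>1 + c * x\<close> turns \<open>1 + w * c\<close> into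
    \<open>1 + (c + c) * x\<close>, the denominator of \<open>bar x\<close>.\<close>
  have bw: "bar x * (1 + w * c) = - w"
  proof (rule mps_mult_cancel)
    show "mps_nth (1 + c * x) {#} = 1" by (simp add: mps_nth_mult_empty x0)
    have "bar x * (1 + w * c) * (1 + c * x) = - (w * (1 + c * x))"
      unfolding mult.assoc v bar w ..
    then show "bar x * (1 + w * c) * (1 + c * x) = - w * (1 + c * x)" by simp
  qed
  let ?a = "w * (y + c)" and ?b = "w * c"
  have a0: "mps_nth ?a {#} = 0" and b0: "mps_nth ?b {#} = 0"
    by (simp_all add: mps_nth_mult_empty w0)
  have "powers ?a = (\<lambda>n. kernel_powers (i, j) n + powers ?b n)"
    by (rule ext) (simp add: kernel_powers_eq w_def x_def y_def c_def)
  then have Gab: "odd_exp (powers ?a) = G * odd_exp (powers ?b)"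
    unfolding G_def by (simp add: odd_exp_add null_family_kernel_powers null_family_powers b0)
  have "G * (1 - x * y) = 1 - bar x * y"
  proof (rule mps_mult_cancel)
    \<comment> \<open>This common factor has constant term 1, so it may be cancelled once both
      linear relations have been used.\<close>
    show "mps_nth ((1 + ?b) * (1 - ?b)) {#} = 1" by (simp add: mps_nth_mult_empty w0)
    have "(1 + ?a) * (1 - ?b) = G * (odd_exp (powers ?b) * (1 - ?b)) * (1 - ?a)"
      unfolding odd_exp_powers[OF a0, symmetric] Gab by (simp only: mult_ac)
    then have Gab': "(1 + ?a) * (1 - ?b) = G * (1 + ?b) * (1 - ?a)"
      by (simp only: odd_exp_powers[OF b0])
    have "(1 - x * y) * (1 - ?b) = 1 - ?b - x * (1 - ?b) * y" by (simp add: algebra_simps)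
    then have xy: "(1 - x * y) * (1 - ?b) = 1 - ?a" unfolding x by (simp add: algebra_simps)
    have "(1 - bar x * y) * (1 + ?b) = 1 + ?b - bar x * (1 + ?b) * y" by (simp add: algebra_simps)
    then have bxy: "(1 - bar x * y) * (1 + ?b) = 1 + ?a" unfolding bw by (simp add: algebra_simps)
    have "G * (1 - x * y) * ((1 + ?b) * (1 - ?b)) = G * (1 + ?b) * ((1 - x * y) * (1 - ?b))"
      by (simp only: mult_ac)
    also have "\<dots> = (1 - bar x * y) * (1 + ?b) * (1 - ?b)"
      unfolding xy bxy Gab' ..
    finally show "G * (1 - x * y) * ((1 + ?b) * (1 - ?b)) = (1 - bar x * y) * ((1 + ?b) * (1 - ?b))"
      by (simp only: mult.assoc)
  qed
  then show ?thesis
    unfolding G_def x_def y_def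
    by (intro mps_divide_eq[symmetric]) (use x0 y0 in \<open>simp_all add: mps_nth_mult_empty x_def y_def\<close>)
qed

text \<open>The second factor has no constant term, so both \<open>x_i\<close> and
  \<open>y_j\<close> must divide \<open>m\<close>. Thus \<open>m\<close> leaves only finitely many
  pairs, uniformly in \<open>n\<close>, as \<open>has_uprod_odd_exp\<close> demands; the bound on
  \<open>n\<close> makes the summed family locally finite.\<close>

lemma kernel_powers_nonzero:
  assumes "mps_nth (kernel_powers (i, j) n) m \<noteq> 0"
  shows "n \<le> size m" "Inl i \<in># m" "Inr j \<in># m"
proof -
  let ?u = "round_var (xv i)"
  obtain a where a: "a \<subseteq># m" "mps_nth (?u ^ n) a \<noteq> 0"
    and b: "mps_nth ((yv j + mps_const (beta / 2)) ^ n - mps_const (beta / 2) ^ n) (m - a) \<noteq> 0"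
    using assms unfolding kernel_powers_def fst_conv snd_conv by (rule mps_nth_mult_nonzeroE)
  have "n \<noteq> 0" using b by (cases n) auto
  have "n \<le> size a"
    using mps_nth_power_eq_0[OF mps_nth_round_xv_empty, of a n i] a(2) by (meson not_le)
  also have "size a \<le> size m" using a(1) by (rule size_mset_mono)
  finally show "n \<le> size m" .
  have "set_mset (replicate_mset n i) \<subseteq> relevant (\<lambda>i. round_var (xv i)) a"
    by (rule mps_nth_prod_mset_nonzero_relevant) (use a(2) in simp)
  with \<open>n \<noteq> 0\<close> obtain b where b1: "b \<subseteq># a" "mps_nth ?u b \<noteq> 0"
    by (auto simp: relevant_def)
  obtain b' where b': "b' \<subseteq># b" "mps_nth (xv i) b' \<noteq> 0"
    using b1(2) by (rule mps_nth_round_var_nonzeroE)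
  then have "b' = {#Inl i#}" by (simp add: xv_def split: if_splits)
  with b'(1) b1(1) a(1) have "{#Inl i#} \<subseteq># m" by (metis subset_mset.order_trans)
  then show "Inl i \<in># m" by simp
  \<comment> \<open>Back in expanded form, every term carries \<open>yv j\<close> with a positive
    exponent \<open>n - k\<close>.\<close>
  have "mps_nth (\<Sum>k<n. mps_const (of_nat (n choose k) * (beta / 2) ^ k) * yv j ^ (n - k)) (m - a) \<noteq> 0"
    unfolding binomial_lessThan by (rule b)
  then obtain k where k: "k \<in> {..<n}"
    "mps_nth (mps_const (of_nat (n choose k) * (beta / 2) ^ k) * yv j ^ (n - k)) (m - a) \<noteq> 0"
    unfolding mps_nth_sum by (rule sum.not_neutral_contains_not_neutral)
  then have "k < n" "mps_nth (yv j ^ (n - k)) (m - a) \<noteq> 0" by auto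
  then have "m - a = replicate_mset (n - k) (Inr j)" "0 < n - k"
    by (auto simp: yv_def mps_nth_var_power split: if_splits)
  then have "Inr j \<in># m - a" by simp
  then show "Inr j \<in># m" by (rule in_diffD)
qed

definition kernel_psum :: "nat \<Rightarrow> (nat + nat, qbeta) mps" where
  "kernel_psum n = psum_round n xv * psum_square n yv"

lemma kernel_psum_has_sum: "((\<lambda>p. kernel_powers p n) has_sum kernel_psum n) UNIV"
proof (cases "n = 0")
  \<comment> \<open>At \<open>n = 0\<close> the sum in \<open>psum_round\<close> does not converge,
    but \<open>psum_square 0\<close> is an empty sum, so the product is 0, in agreement with
    \<open>kernel_powers\<close>.\<close>
  case True
  then show ?thesis by (simp add: kernel_powers_def kernel_psum_def psum_square_def has_sum_0)
next
  case False
  have "((\<lambda>(i, j). round_var (xv i) ^ n *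
      ((yv j + mps_const (beta / 2)) ^ n - mps_const (beta / 2) ^ n)) has_sum kernel_psum n) (UNIV \<times> UNIV)"
    unfolding kernel_psum_def using False null_family_xv null_family_yv
    by (intro has_sum_mps_times psum_round_has_sum psum_square_has_sum) (auto simp: null_family_def)
  then show ?thesis by (simp add: kernel_powers_def[abs_def] case_prod_unfold)
qed

lemma null_family_kernel_psum: "null_family kernel_psum"
proof -
  have *: "n \<le> size m \<and> m \<noteq> {#}" if nz: "mps_nth (kernel_psum n) m \<noteq> 0" for n m
  proof -
    obtain p where "p \<in> UNIV" "mps_nth (kernel_powers p n) m \<noteq> 0"
      using kernel_psum_has_sum nz by (rule has_sum_mps_nonzeroE)
    then show ?thesis using kernel_powers_nonzero[of "fst p" "snd p" n m] by auto
  qed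
  have "{n. mps_nth (kernel_psum n) m \<noteq> 0} \<subseteq> {..size m}" for m
    using * by blast
  from finite_subset[OF this] * show ?thesis
    unfolding null_family_def locally_finite_def by blast
qed

lemma has_uprod_kernel:
  "has_uprod (\<lambda>(i, j). (1 - bar (xv i) * yv j) / (1 - xv i * yv j)) (odd_exp kernel_psum) UNIV"
proof -
  have "{p \<in> UNIV. \<exists>n. mps_nth (kernel_powers p n) m \<noteq> 0} \<subseteq> (Inl -` set_mset m) \<times> (Inr -` set_mset m)" for m
    using kernel_powers_nonzero by auto
  from finite_subset[OF this]
  have "has_uprod (\<lambda>p. odd_exp (kernel_powers p)) (odd_exp kernel_psum) UNIV"
    by (intro has_uprod_odd_exp null_family_kernel_powers null_family_kernel_psum kernel_psum_has_sum)
      (simp add: finite_vimageI)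
  moreover have "(\<lambda>p. odd_exp (kernel_powers p)) = (\<lambda>(i, j). (1 - bar (xv i) * yv j) / (1 - xv i * yv j))"
    by (rule ext) (simp add: case_prod_unfold flip: odd_exp_kernel_powers)
  ultimately show ?thesis by (simp only:)
qed

lemma kernel_has_sum:
  "((\<lambda>\<mu>. mps_const (2 ^ size \<mu> / of_nat (z_part \<mu>)) * p_round \<mu> xv * p_square \<mu> yv)
    has_sum odd_exp kernel_psum) OP"
proof -
  have "(\<Prod>i\<in>#\<mu>. kernel_psum i) = p_round \<mu> xv * p_square \<mu> yv" for \<mu>
    by (simp add: kernel_psum_def p_round_def p_square_def prod_mset.distrib)
  with odd_exp_has_sum[OF null_family_kernel_psum] show ?thesis
    by (subst has_sum_cong_neutral[where T = UNIV and g = "odd_exp_term kernel_psum"])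
      (auto simp: odd_exp_term_def weight_def mult.assoc)
qed

section \<open>The deformed power sums as elements of the two algebras\<close>

lemma mps_nth_psum_var:
  assumes "k > 0"
  shows "mps_nth (psum k mps_var) m = (if \<exists>i. m = replicate_mset k i then 1 else 0)"
proof -
  have has: "((\<lambda>i. mps_var i ^ k :: series) has_sum psum k mps_var) UNIV"
    using null_family_mps_var assms
    by (intro psum_has_sum) (simp_all add: null_family_def)
  show ?thesis
  proof (cases "\<exists>i. m = replicate_mset k i")
    case True
    then obtain i where i: "m = replicate_mset k i" by blast
    have "mps_nth (psum k mps_var) m = (\<Sum>i\<in>{i}. mps_nth (mps_var i ^ k :: series) m)"
      by (rule has_sum_mps_nth[OF has]) (use assms in \<open>auto simp: mps_nth_var_power i replicate_mset_eq_iff\<close>)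
    with True show ?thesis by (simp add: mps_nth_var_power i)
  next
    case False
    have "mps_nth (psum k mps_var) m = (\<Sum>i\<in>{}. mps_nth (mps_var i ^ k :: series) m)"
      by (rule has_sum_mps_nth[OF has]) (use False in \<open>auto simp: mps_nth_var_power\<close>)
    with False show ?thesis by simp
  qed
qed

text \<open>Only local finiteness is assumed, because the substitution defining
  \<open>gGamma\<close> has the constant term \<open>- beta\<close>. Convergence is checked
  directly: a power sum involves only pure powers, which are indexed injectively by the
  variables.\<close>

lemma has_subst_psum:
  fixes z :: "nat \<Rightarrow> ('w, qbeta) mps"
  assumes z: "locally_finite z" and k: "k > 0"
  shows "has_subst z (psum k mps_var) (psum k z)"
proof -
  let ?g = "\<lambda>a. mps_const (mps_nth (psum k mps_var) a) * (\<Prod>i\<in>#a. z i)"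
  have g: "?g (replicate_mset k i) = z i ^ k" for i
  proof -
    have "\<exists>j. replicate_mset k i = replicate_mset k j" by blast
    then show ?thesis by (simp add: mps_nth_psum_var[OF k])
  qed
  have "inj (replicate_mset k :: nat \<Rightarrow> _)" using k by (simp add: inj_def replicate_mset_eq_iff)
  then have "(?g has_sum psum k z) (range (replicate_mset k)) \<longleftrightarrow> ((\<lambda>i. z i ^ k) has_sum psum k z) UNIV"
    by (subst has_sum_reindex) (simp_all only: o_def g)
  with psum_has_sum[OF z k] have "(?g has_sum psum k z) (range (replicate_mset k))" by simp
  then show ?thesis
    unfolding has_subst_def
    by (subst has_sum_cong_neutral[where T = "range (replicate_mset k)" and g = ?g])
      (auto simp: mps_nth_psum_var[OF k])
qed

lemma has_subst_p_square:
  assumes "locally_finite z"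
  shows "has_subst z (p_square \<mu> mps_var) (p_square \<mu> z)"
  unfolding p_square_def psum_square_def
  by (intro has_subst_prod_mset has_subst_sum has_subst_mult has_subst_const has_subst_psum assms) simp

lemma mps_subst_p_round:
  assumes z: "null_family z" and \<mu>: "\<mu> \<in> OP"
  shows "mps_subst z (p_round \<mu> mps_var) = p_round \<mu> z"
proof -
  have w: "mps_subst z (round_var (mps_var i)) = round_var (z i)" for i
    unfolding round_var_def by (subst mps_subst_divide[OF z])
      (simp_all add: mps_nth_mult_empty mps_subst_null_simps[OF z])
  have "mps_subst z (psum_round k mps_var) = psum_round k z" if "k > 0" for k
    using mps_subst_has_sum[OF z psum_round_has_sum[OF null_family_mps_var that]]
    unfolding mps_subst_null_simps[OF z] w by (simp add: psum_round_eq psum_def infsumI)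
  moreover have "k > 0" if "k \<in># \<mu>" for k using \<mu> that by (auto simp: OP_def intro: odd_pos)
  ultimately show ?thesis
    unfolding p_round_def mps_subst_null_simps(7)[OF z]
    by (intro arg_cong[of _ _ prod_mset] image_mset_cong) simp
qed

text \<open>The series comes from a one-variable series by inserting \<open>mps_var i\<close>, so a
  single coefficient sequence \<open>r\<close> serves all variables. The type \<open>unit\<close>
  provides the one variable.\<close>

lemma mps_nth_round_var_power:
  fixes n :: nat
  obtains r :: "nat \<Rightarrow> qbeta" where "\<And>(i :: 'v) m. mps_nth (round_var (mps_var i) ^ n) m =
    (if m = replicate_mset (size m) i then r (size m) else 0)"
proof
  fix i :: 'v and m :: "'v multiset"
  define z where "z = (\<lambda>_::unit. mps_var i :: ('v, qbeta) mps)"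
  define W where "W = (round_var (mps_var ()) ^ n :: (unit, qbeta) mps)"
  define B where "B = {replicate_mset (size m) ()}"
  have z: "null_family z" by (simp add: z_def null_family_def locally_finite_def)
  have "round_var (mps_var i) ^ n = mps_subst z W"
    unfolding W_def mps_subst_null_simps[OF z] unfolding round_var_def
    by (subst mps_subst_divide[OF z])
      (simp_all add: mps_nth_mult_empty mps_subst_null_simps[OF z], simp add: z_def)
  moreover have "mps_nth (mps_subst z W) m =
    (\<Sum>a\<in>B. mps_nth (mps_const (mps_nth W a) * (\<Prod>j\<in>#a. z j)) m)"
  proof (rule has_sum_mps_nth[OF has_subst_null[OF z, unfolded has_subst_def]])
    fix a :: "unit multiset" assume "a \<notin> B"
    have a: "a = replicate_mset (size a) ()" by (induction a) auto
    with \<open>a \<notin> B\<close> have "size a \<noteq> size m" by (metis B_def singletonI)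
    have "(\<Prod>j\<in>#a. z j) = mps_var i ^ size a" by (subst a) (simp add: z_def)
    with \<open>size a \<noteq> size m\<close> show "mps_nth (mps_const (mps_nth W a) * (\<Prod>j\<in>#a. z j)) m = 0"
      by (auto simp: mps_nth_var_power)
  qed (auto simp: B_def)
  ultimately show "mps_nth (round_var (mps_var i) ^ n) m = (if m = replicate_mset (size m) i
      then mps_nth (round_var (mps_var ()) ^ n) (replicate_mset (size m) ()) else 0)"
    by (simp add: B_def W_def z_def mps_nth_var_power)
qed

text \<open>The entry at 0 replaces the divergent sum of zeroth powers and makes the family null.
  Evaluation at it is then a ring homomorphism with image in \<open>Lambda_hat\<close>, which gives
  closure under products.\<close>

definition plain_family :: "nat \<Rightarrow> series" where
  "plain_family k = (if k = 0 then 0 else psum k mps_var)"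

lemma plain_family_nonzero: "mps_nth (plain_family k) m \<noteq> 0 \<Longrightarrow> k = size m \<and> k > 0"
  by (auto simp: plain_family_def mps_nth_psum_var split: if_splits)

lemma null_family_plain: "null_family plain_family"
proof -
  have "{k. mps_nth (plain_family k) m \<noteq> 0} \<subseteq> {size m}" for m
    using plain_family_nonzero by auto
  from finite_subset[OF this] show ?thesis
    using plain_family_nonzero[of _ "{#}"] by (force simp: null_family_def locally_finite_def)
qed

lemma mps_subst_plain_in_Lambda_hat: "mps_subst plain_family C \<in> Lambda_hat"
proof -
  let ?t = "\<lambda>\<mu>. mps_const (mps_nth C \<mu>) * (\<Prod>k\<in>#\<mu>. plain_family k)"
  have eq: "(\<Prod>k\<in>#\<mu>. plain_family k) = p_plain \<mu> mps_var" if "\<mu> \<in> Partitions" for \<mu>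
    unfolding p_plain_def
    by (intro arg_cong[of _ _ prod_mset] image_mset_cong)
      (use that in \<open>auto simp: plain_family_def Partitions_def\<close>)
  have zero: "?t \<mu> = 0" if "\<mu> \<notin> Partitions" for \<mu>
    using that by (force simp: Partitions_def plain_family_def dest!: multi_member_split)
  have "(?t has_sum mps_subst plain_family C) UNIV"
    using has_subst_null[OF null_family_plain] by (simp add: has_subst_def)
  then have "((\<lambda>\<mu>. mps_const (mps_nth C \<mu>) * p_plain \<mu> mps_var) has_sum mps_subst plain_family C) Partitions"
    by (subst has_sum_cong_neutral[where T = UNIV and g = ?t]) (auto simp: eq zero)
  then show ?thesis unfolding Lambda_hat_def by blast
qed

lemma psum_round_eq_subst_plain:
  assumes n: "n > 0"
  shows "\<exists>C. psum_round n mps_var = mps_subst plain_family C"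
proof -
  obtain r where r: "\<And>(i :: nat) m. mps_nth (round_var (mps_var i) ^ n) m =
      (if m = replicate_mset (size m) i then r (size m) else 0)"
    using mps_nth_round_var_power[of n] by blast
  \<comment> \<open>Supported on singletons, this encodes the linear expansion of the deformed power
    sum as the sum of \<open>r k\<close> times the \<open>k\<close>-th power sum.\<close>
  define C where "C = Abs_mps (\<lambda>a. if size a = 1 then r (sum_mset a) else 0)"
  note has = psum_round_has_sum[OF null_family_mps_var n]
  have "has_subst plain_family C (psum_round n mps_var)"
    unfolding has_subst_def
  proof (rule has_sum_mpsI)
    fix m :: "nat multiset"
    \<comment> \<open>By homogeneity only the power sum of degree \<open>size m\<close> can reach
      \<open>m\<close>.\<close>
    let ?B = "{{#size m#}}"
    show "finite ?B" "?B \<subseteq> UNIV" by auto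
    show "mps_nth (mps_const (mps_nth C a) * (\<Prod>k\<in>#a. plain_family k)) m = 0" if "a \<notin> ?B" for a
    proof (cases "size a = 1")
      case True
      then obtain k where a: "a = {#k#}" using size_1_singleton_mset by blast
      with that have "mps_nth (plain_family k) m = 0" using plain_family_nonzero[of k m] by auto
      then show ?thesis by (simp add: a)
    qed (simp add: C_def)
    have "mps_nth (psum_round n mps_var) m = r (size m) * mps_nth (plain_family (size m)) m"
    proof (cases "m \<noteq> {#} \<and> (\<exists>i. m = replicate_mset (size m) i)")
      case True
      then obtain i where i: "m = replicate_mset (size m) i" and m: "m \<noteq> {#}" by blast
      have "size m > 0" using m by (simp add: nonempty_has_size)
      have "mps_nth (psum_round n mps_var) m = (\<Sum>i\<in>{i}. mps_nth (round_var (mps_var i) ^ n) m)"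
      proof (rule has_sum_mps_nth[OF has])
        fix j :: nat assume "j \<notin> {i}"
        then have "m \<noteq> replicate_mset (size m) j"
          using i \<open>size m > 0\<close> by (metis replicate_mset_eq_iff singletonI less_numeral_extra(3))
        then show "mps_nth (round_var (mps_var j) ^ n) m = 0" by (simp add: r)
      qed auto
      with i have "mps_nth (psum_round n mps_var) m = r (size m)" by (simp add: r)
      moreover have "mps_nth (plain_family (size m)) m = 1"
        using True m \<open>size m > 0\<close> by (simp add: plain_family_def mps_nth_psum_var)
      ultimately show ?thesis by simp
    next
      case False
      have "mps_nth (psum_round n mps_var) m = (\<Sum>i\<in>{}. mps_nth (round_var (mps_var i) ^ n) m)"
      proof (rule has_sum_mps_nth[OF has])
        fix i :: nat
        show "mps_nth (round_var (mps_var i) ^ n) m = 0"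
        proof (cases "m = {#}")
          case True
          have "mps_nth (round_var (mps_var i :: series)) {#} = 0"
            using null_family_round_var[OF null_family_mps_var] by (simp add: null_family_def)
          then show ?thesis using True n by (intro mps_nth_power_eq_0) simp_all
        next
          case nonempty: False
          with False have "m \<noteq> replicate_mset (size m) i" by blast
          then show ?thesis by (simp add: r)
        qed
      qed auto
      moreover have "mps_nth (plain_family (size m)) m = 0"
        using False by (cases "m = {#}") (simp_all add: plain_family_def mps_nth_psum_var nonempty_has_size)
      ultimately show ?thesis by simp
    qed
    then show "mps_nth (psum_round n mps_var) m =
        (\<Sum>a\<in>?B. mps_nth (mps_const (mps_nth C a) * (\<Prod>k\<in>#a. plain_family k)) m)"
      by (simp add: C_def)
  qed
  then show ?thesis using has_subst_imp_eq by metis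
qed

lemma p_round_in_Lambda_hat:
  assumes "\<mu> \<in> OP"
  shows "p_round \<mu> mps_var \<in> Lambda_hat"
proof -
  have "\<exists>C. p_round \<mu> mps_var = mps_subst plain_family C"
    using assms
  proof (induction \<mu>)
    case empty
    show ?case using mps_subst_null_simps(5)[OF null_family_plain] by (auto simp: p_round_def)
  next
    case (add k \<mu>)
    then obtain C where C: "p_round \<mu> mps_var = mps_subst plain_family C" by (auto simp: OP_def)
    have "k > 0" using add.prems by (auto simp: OP_def intro: odd_pos)
    then obtain D where D: "psum_round k mps_var = mps_subst plain_family D"
      using psum_round_eq_subst_plain by blast
    have "p_round (add_mset k \<mu>) mps_var = mps_subst plain_family (D * C)"
      unfolding mps_subst_null_simps(1)[OF null_family_plain] C[symmetric] D[symmetric]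
      by (simp add: p_round_def)
    then show ?case by blast
  qed
  then show ?thesis using mps_subst_plain_in_Lambda_hat by auto
qed

section \<open>Independence of the variable \<open>t\<close>\<close>

lemma mps_indep_mult: "mps_indep i f \<Longrightarrow> mps_indep i g \<Longrightarrow> mps_indep i (f * g)"
  for f g :: "('v, 'a::comm_ring_1) mps"
  unfolding mps_indep_def
proof (intro allI impI, rule ccontr)
  fix m assume f: "\<forall>m. i \<in># m \<longrightarrow> mps_nth f m = 0" and g: "\<forall>m. i \<in># m \<longrightarrow> mps_nth g m = 0"
    and i: "i \<in># m" and nz: "mps_nth (f * g) m \<noteq> 0"
  from nz obtain a where a: "a \<subseteq># m" "mps_nth f a \<noteq> 0" "mps_nth g (m - a) \<noteq> 0"
    by (rule mps_nth_mult_nonzeroE)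
  have "i \<in># a \<or> i \<in># m - a"
    using i subset_mset.add_diff_inverse[OF a(1)] union_iff[of i a "m - a"] by simp
  then show False using a(2,3) f g by blast
qed

lemma mps_indep_const: "mps_indep i (mps_const c :: ('v, 'a::comm_ring_1) mps)"
  by (auto simp: mps_indep_def)

lemma mps_indep_power: "mps_indep i f \<Longrightarrow> mps_indep i (f ^ n)"
  for f :: "('v, 'a::comm_ring_1) mps"
  using mps_indep_const[of i "1 :: 'a"] by (induction n) (simp_all add: mps_indep_mult)

lemma mps_indep_prod_mset:
  fixes f :: "'x \<Rightarrow> ('v, 'a::comm_ring_1) mps"
  shows "(\<And>x. x \<in># \<mu> \<Longrightarrow> mps_indep i (f x)) \<Longrightarrow> mps_indep i (\<Prod>x\<in>#\<mu>. f x)"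
  using mps_indep_const[of i "1 :: 'a"] by (induction \<mu>) (simp_all add: mps_indep_mult)

text \<open>After either substitution, the terms numbered 0 and 1 both involve \<open>t\<close>;
  only their sum has to be free of it.\<close>

lemma mps_indep_cancel:
  fixes f :: "nat \<Rightarrow> ('v, 'a::comm_ring_1) mps"
  assumes f: "(f has_sum F) UNIV" and "\<And>j. j \<noteq> 0 \<Longrightarrow> j \<noteq> 1 \<Longrightarrow> mps_indep i (f j)"
    and "mps_indep i (f 0 + f 1)"
  shows "mps_indep i F"
  unfolding mps_indep_def
proof (intro allI impI)
  fix m assume "i \<in># m"
  have "mps_nth F m = (\<Sum>j\<in>{0, 1}. mps_nth (f j) m)"
    by (rule has_sum_mps_nth[OF f]) (use assms(2) \<open>i \<in># m\<close> in \<open>auto simp: mps_indep_def\<close>)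
  also have "\<dots> = mps_nth (f 0 + f 1) m" by simp
  also have "\<dots> = 0" using assms(3) \<open>i \<in># m\<close> by (auto simp: mps_indep_def)
  finally show "mps_nth F m = 0" .
qed

text \<open>In terms of reciprocals, \<open>1 / round_var u = 1 / u + beta / 2\<close> and
  \<open>1 / bar u = - 1 / u - beta\<close>: the shift by \<open>beta / 2\<close> moves the centre
  of the involution to 0. The proof is this computation with denominators cleared.\<close>

lemma round_var_bar:
  assumes u: "mps_nth u {#} = 0"
  shows "round_var (bar u) = - round_var u"
proof -
  define c where "c = (mps_const (beta / 2) :: ('a, qbeta) mps)"
  define w where "w = round_var u"
  have cc: "mps_const beta = c + c" by (simp add: c_def flip: mps_const_hom(3))
  have w: "w * (1 + c * u) = u" unfolding w_def c_def by (rule round_var_mult[OF u])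
  have b: "bar u * (1 + (c + c) * u) = - u"
    unfolding bar_def cc by (rule mps_divide_mult_cancel) (simp add: mps_nth_mult_empty u)
  have b0: "mps_nth (bar u) {#} = 0" by (simp add: bar_def divide_mps_def mps_nth_mult_empty u)
  have "bar u = - w * (1 + c * bar u)"
  proof (rule mps_mult_cancel)
    show "mps_nth (1 + (c + c) * u) {#} = 1" by (simp add: mps_nth_mult_empty u)
    have "- w * (1 + c * bar u) * (1 + (c + c) * u) =
      - (w * (1 + (c + c) * u + c * (bar u * (1 + (c + c) * u))))" by (simp add: algebra_simps)
    also have "\<dots> = - (w * (1 + c * u))" unfolding b by (simp add: algebra_simps)
    also have "\<dots> = - u" unfolding w ..
    finally show "bar u * (1 + (c + c) * u) = - w * (1 + c * bar u) * (1 + (c + c) * u)"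
      unfolding b ..
  qed
  then show ?thesis
    unfolding round_var_def[of "bar u"] w_def[symmetric] c_def[symmetric]
    by (intro mps_divide_eq) (simp_all add: mps_nth_mult_empty b0)
qed

lemma p_round_in_GGamma:
  assumes \<mu>: "\<mu> \<in> OP"
  shows "p_round \<mu> mps_var \<in> GGamma"
proof -
  define z where "z = (mps_var :: nat \<Rightarrow> series)(1 := bar (mps_var 0))"
  have "{i. mps_nth (z i) m \<noteq> 0} \<subseteq> insert 1 {i. mps_nth (mps_var i :: series) m \<noteq> 0}" for m
    unfolding z_def by auto
  from finite_subset[OF this] null_family_mps_var have z: "null_family z"
    unfolding null_family_def locally_finite_def
    by (simp add: z_def bar_def divide_mps_def mps_nth_mult_empty)
  have "mps_indep 0 (psum_round k z)" if "k \<in># \<mu>" for k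
  proof -
    have k: "odd k" "k > 0" using \<mu> that by (auto simp: OP_def intro: odd_pos)
    obtain r where r: "\<And>(i :: nat) m. mps_nth (round_var (mps_var i) ^ k) m =
        (if m = replicate_mset (size m) i then r (size m) else 0)"
      using mps_nth_round_var_power[of k] by blast
    show ?thesis
    proof (rule mps_indep_cancel[OF psum_round_has_sum[OF z k(2)]])
      fix j :: nat assume "j \<noteq> 0" "j \<noteq> 1"
      show "mps_indep 0 (round_var (z j) ^ k)"
      proof -
        have "mps_nth (round_var (z j) ^ k) m = 0" if m: "0 \<in># m" for m
        proof -
          have "m \<noteq> replicate_mset (size m) j"
          proof
            assume "m = replicate_mset (size m) j"
            with m have "0 \<in># replicate_mset (size m) j" by (rule subst[rotated])
            with \<open>j \<noteq> 0\<close> show False by (simp split: if_splits)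
          qed
          then show ?thesis using \<open>j \<noteq> 1\<close> by (simp add: z_def r)
        qed
        then show ?thesis by (simp add: mps_indep_def)
      qed
    next
      \<comment> \<open>The two entries are \<open>w\<close> and \<open>- w\<close>, so their odd
        powers cancel.\<close>
      have "round_var (z 0) ^ k + round_var (z 1) ^ k = mps_const 0"
        using k(1) by (simp add: z_def round_var_bar)
      then show "mps_indep 0 (round_var (z 0) ^ k + round_var (z 1) ^ k)"
        by (simp only: mps_indep_const)
    qed
  qed
  then have "mps_indep 0 (p_round \<mu> z)"
    unfolding p_round_def by (rule mps_indep_prod_mset)
  with p_round_in_Lambda_hat[OF \<mu>] mps_subst_p_round[OF z \<mu>] show ?thesis
    by (simp add: GGamma_def z_def)
qed

section \<open>Symmetric functions of bounded degree\<close>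

lemma Lambda_mult:
  assumes "f \<in> Lambda" "g \<in> Lambda"
  shows "f * g \<in> Lambda"
proof -
  have f: "\<And>\<pi> m. bij \<pi> \<Longrightarrow> mps_nth f (image_mset \<pi> m) = mps_nth f m"
    and g: "\<And>\<pi> m. bij \<pi> \<Longrightarrow> mps_nth g (image_mset \<pi> m) = mps_nth g m"
    using assms unfolding Lambda_def by auto
  have "mps_nth (f * g) (image_mset \<pi> m) = mps_nth (f * g) m" if \<pi>: "bij \<pi>" for \<pi> m
  proof -
    have inv: "image_mset (inv \<pi>) (image_mset \<pi> a) = a" "image_mset \<pi> (image_mset (inv \<pi>) a) = a" for a
      using \<pi> by (simp_all add: multiset.map_comp o_def bij_is_inj bij_is_surj inv_f_f surj_f_inv_f)
    have sub: "image_mset (inv \<pi>) a \<subseteq># m" if "a \<subseteq># image_mset \<pi> m" for a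
      using image_mset_subseteq_mono[OF that, of "inv \<pi>"] inv by simp
    have "mps_nth (f * g) m = (\<Sum>a | a \<subseteq># image_mset \<pi> m.
        mps_nth f a * mps_nth g (image_mset \<pi> m - a))"
      unfolding mps_nth_mult
    proof (rule sum.reindex_bij_witness[of _ "image_mset (inv \<pi>)" "image_mset \<pi>"])
      fix a assume "a \<in> {a. a \<subseteq># m}"
      then have a: "a \<subseteq># m" by simp
      show "image_mset \<pi> a \<in> {a. a \<subseteq># image_mset \<pi> m}" using a by (simp add: image_mset_subseteq_mono)
      show "mps_nth f (image_mset \<pi> a) * mps_nth g (image_mset \<pi> m - image_mset \<pi> a) =
          mps_nth f a * mps_nth g (m - a)"
        unfolding image_mset_Diff[OF a, symmetric] f[OF \<pi>] g[OF \<pi>] ..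
    qed (simp_all add: inv sub)
    then show ?thesis by (simp add: mps_nth_mult)
  qed
  moreover obtain d e where d: "\<forall>m. mps_nth f m \<noteq> 0 \<longrightarrow> size m \<le> d" and e: "\<forall>m. mps_nth g m \<noteq> 0 \<longrightarrow> size m \<le> e"
    using assms unfolding Lambda_def by auto
  moreover have "size m \<le> d + e" if nz: "mps_nth (f * g) m \<noteq> 0" for m
  proof -
    obtain a where a: "a \<subseteq># m" "mps_nth f a \<noteq> 0" "mps_nth g (m - a) \<noteq> 0"
      using nz by (rule mps_nth_mult_nonzeroE)
    then have "size a \<le> d" "size (m - a) \<le> e" using d e by auto
    with size_Diff_submset[OF a(1)] show ?thesis by linarith
  qed
  ultimately show ?thesis unfolding Lambda_def by blast
qed

lemma Lambda_const: "mps_const c \<in> Lambda"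
  by (auto simp: Lambda_def)

lemma Lambda_add:
  assumes "f \<in> Lambda" "g \<in> Lambda"
  shows "f + g \<in> Lambda"
proof -
  obtain d e where d: "\<forall>m. mps_nth f m \<noteq> 0 \<longrightarrow> size m \<le> d" and e: "\<forall>m. mps_nth g m \<noteq> 0 \<longrightarrow> size m \<le> e"
    using assms unfolding Lambda_def by auto
  have "size m \<le> d + e" if "mps_nth (f + g) m \<noteq> 0" for m
  proof (cases "mps_nth f m = 0")
    case True
    with that have "size m \<le> e" using e by simp
    then show ?thesis by simp
  next
    case False
    with d have "size m \<le> d" by simp
    then show ?thesis by simp
  qed
  with assms show ?thesis unfolding Lambda_def by auto
qed

lemma Lambda_sum: "(\<And>x. x \<in> X \<Longrightarrow> f x \<in> Lambda) \<Longrightarrow> sum f X \<in> Lambda"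
  using Lambda_const[of 0] by (induction X rule: infinite_finite_induct) (simp_all add: Lambda_add)

lemma Lambda_prod_mset: "(\<And>x. x \<in># \<mu> \<Longrightarrow> f x \<in> Lambda) \<Longrightarrow> (\<Prod>x\<in>#\<mu>. f x) \<in> Lambda"
  using Lambda_const[of 1] by (induction \<mu>) (simp_all add: Lambda_mult)

lemma Lambda_psum:
  assumes k: "k > 0"
  shows "psum k mps_var \<in> Lambda"
proof -
  have "(\<exists>i. image_mset \<pi> m = replicate_mset k i) \<longleftrightarrow> (\<exists>i. m = replicate_mset k i)" if \<pi>: "bij \<pi>" for \<pi> m
  proof
    assume "\<exists>i. image_mset \<pi> m = replicate_mset k i"
    then obtain i where "image_mset \<pi> m = replicate_mset k i" by blast
    then have "image_mset (inv \<pi>) (image_mset \<pi> m) = replicate_mset k (inv \<pi> i)" by simp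
    moreover have "image_mset (inv \<pi>) (image_mset \<pi> m) = m"
      using \<pi> by (simp add: multiset.map_comp o_def bij_is_inj)
    ultimately show "\<exists>i. m = replicate_mset k i" by auto
  qed auto
  moreover have "size m \<le> k" if "mps_nth (psum k mps_var) m \<noteq> 0" for m
    using that by (auto simp: mps_nth_psum_var[OF k] split: if_splits)
  ultimately show ?thesis unfolding Lambda_def by (auto simp: mps_nth_psum_var[OF k])
qed

lemma const_mult_p_square_in_gGamma:
  assumes \<mu>: "\<mu> \<in> OP"
  shows "mps_const s * p_square \<mu> mps_var \<in> gGamma"
proof -
  define z where "z = (mps_var :: nat \<Rightarrow> series)(1 := - mps_var 0 - mps_const beta)"
  define c where "c = (mps_const (beta / 2) :: series)"
  have "{i. mps_nth (z i) m \<noteq> 0} \<subseteq> insert 1 {i. mps_nth (mps_var i :: series) m \<noteq> 0}" for m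
    unfolding z_def by auto
  from finite_subset[OF this] null_family_mps_var have z: "locally_finite z"
    unfolding null_family_def locally_finite_def by simp
  have "mps_indep 0 (psum_square k z)" if "k \<in># \<mu>" for k
  proof (rule mps_indep_cancel[OF psum_square_has_sum[OF z]])
    have k: "odd k" using \<mu> that by (auto simp: OP_def)
    have diff: "mps_indep 0 (f - g)" if "mps_indep 0 f" "mps_indep 0 g" for f g :: series
      using that by (simp add: mps_indep_def)
    {
      fix j :: nat assume "j \<noteq> 0" "j \<noteq> 1"
      then have "mps_indep 0 (z j + c)"
        by (auto simp: z_def c_def mps_indep_def)
      then show "mps_indep 0 ((z j + mps_const (beta / 2)) ^ k - mps_const (beta / 2) ^ k)"
        by (auto intro: diff mps_indep_power mps_indep_const simp: c_def)
    }
    have "mps_const beta = c + c" by (simp add: c_def flip: mps_const_hom(3))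
    \<comment> \<open>Centring at \<open>- beta / 2\<close> turns
      \<open>y \<mapsto> - y - beta\<close> into negation. The odd powers cancel and leave the
      constant \<open>- 2 c ^ k\<close>, which is nonzero but free of \<open>t\<close>.\<close>
    then have "z 1 + c = - (z 0 + c)" by (simp add: z_def)
    then have "(z 1 + c) ^ k = - ((z 0 + c) ^ k)" by (simp only: power_minus_odd[OF k])
    then have "(z 0 + c) ^ k - c ^ k + ((z 1 + c) ^ k - c ^ k) =
        mps_const (- ((beta / 2) ^ k)) - mps_const ((beta / 2) ^ k)"
      by (simp add: c_def mps_const_power)
    then show "mps_indep 0 ((z 0 + mps_const (beta / 2)) ^ k - mps_const (beta / 2) ^ k +
        ((z 1 + mps_const (beta / 2)) ^ k - mps_const (beta / 2) ^ k))"
      unfolding c_def by (simp only: diff mps_indep_const)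
  qed
  then have "mps_indep 0 (mps_const s * p_square \<mu> z)"
    unfolding p_square_def by (intro mps_indep_mult mps_indep_const mps_indep_prod_mset)
  moreover have "mps_subst z (mps_const s * p_square \<mu> mps_var) = mps_const s * p_square \<mu> z"
    by (intro has_subst_imp_eq has_subst_mult has_subst_const has_subst_p_square z)
  moreover have "mps_const s * p_square \<mu> mps_var \<in> Lambda"
    unfolding p_square_def psum_square_def
    by (intro Lambda_mult Lambda_const Lambda_prod_mset Lambda_sum Lambda_psum) simp
  ultimately show ?thesis by (simp add: gGamma_def z_def)
qed

section \<open>Linear independence\<close>

text \<open>The exponent partition of a monomial; the monomials with exponents \<open>\<mu>\<close>
  are those of the monomial symmetric function of \<open>\<mu>\<close>.\<close>

definition exponents :: "'v multiset \<Rightarrow> nat multiset" where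
  "exponents m = image_mset (count m) (mset_set (set_mset m))"

lemma size_exponents: "size (exponents m) = card (set_mset m)"
  by (simp add: exponents_def)

lemma exponents_add_replicate:
  assumes "i \<notin># m" "k > 0"
  shows "exponents (replicate_mset k i + m) = add_mset k (exponents m)"
proof -
  have "image_mset (count (replicate_mset k i + m)) (mset_set (set_mset m)) = exponents m"
    unfolding exponents_def using assms(1) by (intro image_mset_cong) auto
  moreover have "count m i = 0" using assms(1) by (simp add: not_in_iff)
  ultimately show ?thesis using assms by (simp add: exponents_def)
qed

lemma exists_exponents:
  assumes "0 \<notin># \<mu>"
  shows "\<exists>m :: nat multiset. exponents m = \<mu>"
  using assms
proof (induction \<mu>)
  case empty
  have "exponents ({#} :: nat multiset) = {#}" by (simp add: exponents_def)
  then show ?case by blast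
next
  case (add k \<mu>)
  then obtain m :: "nat multiset" where m: "exponents m = \<mu>" by auto
  obtain i where "i \<notin># m" using ex_new_if_finite[of "set_mset m"] by auto
  then have "exponents (replicate_mset k i + m) = add_mset k \<mu>"
    using add.prems m by (simp add: exponents_add_replicate)
  then show ?case by blast
qed

lemma p_plain_add_mset: "p_plain (add_mset k \<mu>) z = psum k z * p_plain \<mu> z"
  by (simp add: p_plain_def)

lemma mps_nth_p_plain_nonzeroE:
  assumes "mps_nth (p_plain (add_mset k \<mu>) mps_var) m \<noteq> 0" "k > 0"
  obtains i m' where "m = replicate_mset k i + m'" "mps_nth (p_plain \<mu> mps_var) m' \<noteq> 0"
proof -
  obtain a where a: "a \<subseteq># m" "mps_nth (psum k mps_var) a \<noteq> 0" "mps_nth (p_plain \<mu> mps_var) (m - a) \<noteq> 0"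
    using assms(1) unfolding p_plain_add_mset by (rule mps_nth_mult_nonzeroE)
  then obtain i where "a = replicate_mset k i"
    using assms(2) by (auto simp: mps_nth_psum_var split: if_splits)
  then have "m = replicate_mset k i + (m - a)" using subset_mset.add_diff_inverse[OF a(1)] by simp
  then show thesis using a(3) by (rule that)
qed

lemma mps_nth_p_plain_nonzero_size:
  assumes "mps_nth (p_plain \<mu> mps_var) m \<noteq> 0" "0 \<notin># \<mu>"
  shows "size m = sum_mset \<mu>"
  using assms
proof (induction \<mu> arbitrary: m)
  case empty
  then show ?case by (simp add: p_plain_def split: if_splits)
next
  case (add k \<mu>)
  then have "k > 0" by auto
  with add.prems(1) obtain i m' where m: "m = replicate_mset k i + m'"
    and m': "mps_nth (p_plain \<mu> mps_var) m' \<noteq> 0" by (rule mps_nth_p_plain_nonzeroE)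
  have "size m' = sum_mset \<mu>" using m' add.prems(2) by (intro add.IH) auto
  then show ?case by (simp add: m)
qed

text \<open>Triangularity: expanding the product assigns a variable to each part. Distinct variables
  give exponents \<open>\<mu>\<close>, while any coincidence leaves fewer than
  \<open>size \<mu>\<close> variables.\<close>

lemma mps_nth_p_plain_nonzero_exponents:
  assumes "mps_nth (p_plain \<mu> mps_var) m \<noteq> 0" "0 \<notin># \<mu>"
  shows "card (set_mset m) < size \<mu> \<or> exponents m = \<mu>"
  using assms
proof (induction \<mu> arbitrary: m)
  case empty
  then show ?case by (simp add: p_plain_def exponents_def split: if_splits)
next
  case (add k \<mu>)
  then have k: "k > 0" by auto
  with add.prems(1) obtain i m' where m: "m = replicate_mset k i + m'"
    and m': "mps_nth (p_plain \<mu> mps_var) m' \<noteq> 0" by (rule mps_nth_p_plain_nonzeroE)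
  have IH: "card (set_mset m') < size \<mu> \<or> exponents m' = \<mu>"
    using m' add.prems(2) by (intro add.IH) auto
  then have le: "card (set_mset m') \<le> size \<mu>"
    using size_exponents[of m'] by auto
  show ?case
  proof (cases "i \<in># m'")
    case True
    then have "set_mset m = set_mset m'" by (auto simp: m)
    with le show ?thesis by simp
  next
    case False
    then have "card (set_mset m) = Suc (card (set_mset m'))" using k by (simp add: m)
    moreover have "exponents m = add_mset k (exponents m')"
      unfolding m by (rule exponents_add_replicate[OF False k])
    ultimately show ?thesis using IH by auto
  qed
qed

text \<open>All coefficients are natural numbers, so nothing can cancel: one way of splitting
  \<open>m\<close> into pure powers already makes the coefficient positive, hence nonzero in
  characteristic zero.\<close>

lemma mps_nth_p_plain_of_nat:
  assumes "0 \<notin># \<mu>"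
  shows "\<exists>N. mps_nth (p_plain \<mu> mps_var) m = of_nat N \<and> (exponents m = \<mu> \<longrightarrow> N > 0)"
  using assms
proof (induction \<mu> arbitrary: m)
  case empty
  have "m = {#}" if "exponents m = {#}"
    using that by (simp add: exponents_def mset_set_empty_iff)
  then show ?case by (intro exI[of _ "if m = {#} then 1 else 0"]) (auto simp: p_plain_def)
next
  case (add k \<mu>)
  then have k: "k > 0" by auto
  have "\<forall>m. \<exists>N. mps_nth (p_plain \<mu> mps_var) m = of_nat N \<and> (exponents m = \<mu> \<longrightarrow> N > 0)"
    using add.IH add.prems by simp
  then obtain h where h: "\<And>m. mps_nth (p_plain \<mu> mps_var) m = of_nat (h m)"
    and h_pos: "\<And>m. exponents m = \<mu> \<Longrightarrow> h m > 0" by metis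
  define N where "N = (\<Sum>a | a \<subseteq># m. (if \<exists>i. a = replicate_mset k i then 1 else 0) * h (m - a))"
  have "mps_nth (p_plain (add_mset k \<mu>) mps_var) m = of_nat N"
    unfolding N_def p_plain_add_mset mps_nth_mult of_nat_sum
    by (intro sum.cong refl) (simp add: mps_nth_psum_var[OF k] h)
  moreover have "N > 0" if m: "exponents m = add_mset k \<mu>"
  proof -
    have "k \<in># exponents m" by (simp add: m)
    then obtain i where i: "i \<in># m" "count m i = k" by (auto simp: exponents_def)
    let ?a = "replicate_mset k i"
    have a: "?a \<subseteq># m" using i(2) by (simp flip: count_le_replicate_mset_subset_eq)
    then have split: "m = ?a + (m - ?a)" by (simp add: subset_mset.add_diff_inverse)
    have "i \<notin># m - ?a" using i(2) by (simp add: not_in_iff)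
    then have "exponents m = add_mset k (exponents (m - ?a))"
      by (subst split) (rule exponents_add_replicate[OF _ k])
    then have "h (m - ?a) > 0" using m by (intro h_pos) simp
    moreover have "h (m - ?a) \<le> N"
    proof -
      have "(\<Sum>a\<in>{?a}. (if \<exists>i. a = replicate_mset k i then 1 else 0) * h (m - a)) \<le> N"
        unfolding N_def by (rule sum_mono2) (use a in \<open>simp_all add: finite_submultisets\<close>)
      moreover have "\<exists>j. ?a = replicate_mset k j" by blast
      ultimately show ?thesis by simp
    qed
    ultimately show ?thesis by simp
  qed
  ultimately show ?case by blast
qed

lemma mps_nth_p_plain_exponents:
  assumes "0 \<notin># \<mu>" "exponents m = \<mu>"
  shows "mps_nth (p_plain \<mu> mps_var) m \<noteq> 0"
  using mps_nth_p_plain_of_nat[OF assms(1), of m] assms(2) by auto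

text \<open>The sign \<open>e\<close> treats at once families whose lowest (\<open>e = 1\<close>) and whose highest (\<open>e = -1\<close>)
  homogeneous component is the power sum.\<close>

locale deformed_psum =
  fixes e :: int and P :: "nat \<Rightarrow> series"
  assumes leading: "k > 0 \<Longrightarrow> e * int (size a) \<le> e * int k \<Longrightarrow> mps_nth (P k) a = mps_nth (psum k mps_var) a"
begin

text \<open>The degrees of \<open>a\<close> and \<open>m - a\<close> add up to that of
  \<open>m\<close>. Thus either both stay within their bounds, where the leading terms agree, or one
  is strictly inside, where that factor vanishes on both sides by homogeneity of power sums.\<close>

lemma mps_nth_prod_leading:
  assumes "0 \<notin># \<mu>" "e * int (size m) \<le> e * int (sum_mset \<mu>)"
  shows "mps_nth (\<Prod>k\<in>#\<mu>. P k) m = mps_nth (p_plain \<mu> mps_var) m"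
  using assms
proof (induction \<mu> arbitrary: m)
  case (add k \<mu>)
  then have k: "k > 0" and \<mu>: "0 \<notin># \<mu>" by auto
  have "mps_nth (P k) a * mps_nth (\<Prod>k\<in>#\<mu>. P k) (m - a) =
      mps_nth (psum k mps_var) a * mps_nth (p_plain \<mu> mps_var) (m - a)" if a: "a \<subseteq># m" for a
  proof -
    have size_m: "e * int (size m) = e * int (size a) + e * int (size (m - a))"
      using size_Diff_submset[OF a] size_mset_mono[OF a] by (simp flip: distrib_left)
    have sum: "e * int (sum_mset (add_mset k \<mu>)) = e * int k + e * int (sum_mset \<mu>)"
      by (simp add: distrib_left)
    consider "e * int (size a) \<le> e * int k" "e * int (size (m - a)) \<le> e * int (sum_mset \<mu>)"
      | "e * int (size a) < e * int k" | "e * int (size (m - a)) < e * int (sum_mset \<mu>)"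
      using add.prems(2) size_m sum by linarith
    then show ?thesis
    proof cases
      case 1
      then show ?thesis by (simp add: leading k add.IH \<mu>)
    next
      case 2
      then have "mps_nth (psum k mps_var) a = 0" by (auto simp: mps_nth_psum_var k)
      with 2 show ?thesis by (simp add: leading k)
    next
      case 3
      then have "mps_nth (p_plain \<mu> mps_var) (m - a) = 0"
        using mps_nth_p_plain_nonzero_size[OF _ \<mu>, of "m - a"] less_irrefl by metis
      moreover have "mps_nth (\<Prod>k\<in>#\<mu>. P k) (m - a) = mps_nth (p_plain \<mu> mps_var) (m - a)"
        using 3 \<mu> by (intro add.IH) simp_all
      ultimately show ?thesis by simp
    qed
  qed
  then show ?case by (simp add: p_plain_add_mset mps_nth_mult)
qed (simp add: p_plain_def)

text \<open>Among the terms of extremal weight, one of greatest length is chosen; at a monomial with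
  its exponents, every other term vanishes by homogeneity or by triangularity.\<close>

lemma independent:
  assumes A: "\<And>\<mu>. \<mu> \<in> A \<Longrightarrow> 0 \<notin># \<mu>"
    and zero: "((\<lambda>\<mu>. mps_const (c \<mu>) * (\<Prod>k\<in>#\<mu>. P k)) has_sum 0) A"
    and \<mu>0: "\<mu>0 \<in> A" "c \<mu>0 \<noteq> 0"
    and extremal: "\<And>\<mu>. \<mu> \<in> A \<Longrightarrow> c \<mu> \<noteq> 0 \<Longrightarrow> e * int (sum_mset \<mu>0) \<le> e * int (sum_mset \<mu>)"
  shows False
proof -
  let ?Q = "\<lambda>\<mu>. \<mu> \<in> A \<and> c \<mu> \<noteq> 0 \<and> sum_mset \<mu> = sum_mset \<mu>0"
  \<comment> \<open>Positive parts bound the length by the weight, so a greatest length exists even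
    in an infinite family.\<close>
  have "\<forall>\<mu>. ?Q \<mu> \<longrightarrow> size \<mu> < Suc (sum_mset \<mu>0)"
  proof (intro allI impI)
    fix \<mu> assume "?Q \<mu>"
    then show "size \<mu> < Suc (sum_mset \<mu>0)" using size_le_sum_mset[of \<mu>] A[of \<mu>] by auto
  qed
  moreover have "?Q \<mu>0" using \<mu>0 by simp
  ultimately obtain \<mu> where Q: "?Q \<mu>" and max: "\<forall>\<nu>. ?Q \<nu> \<longrightarrow> size \<nu> \<le> size \<mu>"
    using ex_has_greatest_nat[of ?Q \<mu>0 size "Suc (sum_mset \<mu>0)"] by blast
  have \<mu>: "0 \<notin># \<mu>" using Q A by blast
  obtain m :: "nat multiset" where m: "exponents m = \<mu>" using exists_exponents[OF \<mu>] by blast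
  have p: "mps_nth (p_plain \<mu> mps_var) m \<noteq> 0" by (rule mps_nth_p_plain_exponents[OF \<mu> m])
  have size_m: "size m = sum_mset \<mu>0" using mps_nth_p_plain_nonzero_size[OF p \<mu>] Q by simp
  have "mps_nth 0 m = (\<Sum>\<nu>\<in>{\<mu>}. mps_nth (mps_const (c \<nu>) * (\<Prod>k\<in>#\<nu>. P k)) m)"
  proof (rule has_sum_mps_nth[OF zero])
    fix \<nu> assume \<nu>: "\<nu> \<in> A" "\<nu> \<notin> {\<mu>}"
    show "mps_nth (mps_const (c \<nu>) * (\<Prod>k\<in>#\<nu>. P k)) m = 0"
    proof (rule ccontr)
      assume "mps_nth (mps_const (c \<nu>) * (\<Prod>k\<in>#\<nu>. P k)) m \<noteq> 0"
      then have c: "c \<nu> \<noteq> 0" and P: "mps_nth (\<Prod>k\<in>#\<nu>. P k) m \<noteq> 0" by auto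
      have \<nu>0: "0 \<notin># \<nu>" using A \<nu>(1) by blast
      have "mps_nth (\<Prod>k\<in>#\<nu>. P k) m = mps_nth (p_plain \<nu> mps_var) m"
        by (rule mps_nth_prod_leading[OF \<nu>0]) (use extremal[OF \<nu>(1) c] size_m in simp)
      with P have p': "mps_nth (p_plain \<nu> mps_var) m \<noteq> 0" by simp
      have "?Q \<nu>" using \<nu>(1) c mps_nth_p_plain_nonzero_size[OF p' \<nu>0] size_m by simp
      with max have "size \<nu> \<le> size \<mu>" by blast
      moreover have "card (set_mset m) = size \<mu>" using size_exponents[of m] m by simp
      \<comment> \<open>The monomial has \<open>size \<mu>\<close> variables, at least as many as
        \<open>\<nu>\<close> has parts, so the coincidence case is excluded.\<close>
      ultimately have "exponents m = \<nu>"
        using mps_nth_p_plain_nonzero_exponents[OF p' \<nu>0] by linarith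
      with m \<nu>(2) show False by simp
    qed
  qed (use Q in auto)
  moreover have "mps_nth (\<Prod>k\<in>#\<mu>. P k) m = mps_nth (p_plain \<mu> mps_var) m"
    by (rule mps_nth_prod_leading[OF \<mu>]) (use Q size_m in simp)
  ultimately show False using p Q by simp
qed

end

text \<open>Write \<open>u ^ k = w ^ k * g\<close> with \<open>g\<close> of constant term 1. Since
  \<open>w ^ k\<close> has no terms of degree below \<open>k\<close>, only the constant term of
  \<open>g\<close> matters up to degree \<open>k\<close>.\<close>

lemma mps_nth_power_round_var:
  assumes u: "mps_nth u {#} = 0" and m: "size m \<le> k"
  shows "mps_nth (round_var u ^ k) m = mps_nth (u ^ k) m"
proof -
  let ?w = "round_var u"
  define g where "g = (1 + mps_const (beta / 2) * u) ^ k"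
  have w: "mps_nth ?w {#} = 0" by (simp add: round_var_def divide_mps_def mps_nth_mult_empty u)
  have g: "mps_nth g {#} = 1"
    unfolding g_def by (induction k) (simp_all add: mps_nth_mult_empty u)
  have "u ^ k = ?w ^ k * g"
    unfolding g_def by (subst (1) round_var_mult[OF u, symmetric]) (rule power_mult_distrib)
  also have "mps_nth \<dots> m = (\<Sum>a\<in>{m}. mps_nth (?w ^ k) a * mps_nth g (m - a))"
    unfolding mps_nth_mult
  proof (rule sum.mono_neutral_right)
    show "\<forall>a\<in>{a. a \<subseteq># m} - {m}. mps_nth (?w ^ k) a * mps_nth g (m - a) = 0"
    proof
      fix a assume "a \<in> {a. a \<subseteq># m} - {m}"
      then have "a \<subset># m" by (simp add: subset_mset.less_le)
      then have "size a < k" using m mset_subset_size[of a m] by simp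
      then show "mps_nth (?w ^ k) a * mps_nth g (m - a) = 0"
        using mps_nth_power_eq_0[OF w] by simp
    qed
  qed (simp_all add: finite_submultisets)
  finally show ?thesis by (simp add: g)
qed

interpretation round: deformed_psum 1 "\<lambda>k. psum_round k mps_var"
proof
  fix k :: nat and a :: "nat multiset"
  assume k: "k > 0" and a: "1 * int (size a) \<le> 1 * int k"
  have has: "((\<lambda>i. mps_var i ^ k :: series) has_sum psum k mps_var) UNIV"
    using k null_family_mps_var by (intro psum_has_sum) (simp_all add: null_family_def)
  let ?B = "{i \<in> UNIV. mps_nth (mps_var i ^ k :: series) a \<noteq> 0}"
  have fin: "finite ?B" by (rule has_sum_mps_nth_supp[OF has])
  have eq: "mps_nth (round_var (mps_var i) ^ k) a = mps_nth (mps_var i ^ k) a" for i :: nat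
    using a by (intro mps_nth_power_round_var) simp_all
  have "mps_nth (psum_round k mps_var) a = (\<Sum>i\<in>?B. mps_nth (round_var (mps_var i) ^ k) a)"
    by (rule has_sum_mps_nth[OF psum_round_has_sum[OF null_family_mps_var k] fin]) (auto simp: eq)
  also have "\<dots> = mps_nth (psum k mps_var) a"
    unfolding eq by (rule has_sum_mps_nth[OF has fin, symmetric]) auto
  finally show "mps_nth (psum_round k mps_var) a = mps_nth (psum k mps_var) a" .
qed

interpretation square: deformed_psum "-1" "\<lambda>k. psum_square k mps_var"
proof
  fix k :: nat and a :: "nat multiset"
  assume k: "k > 0" and a: "- 1 * int (size a) \<le> - 1 * int k"
  have "mps_nth (psum_square k mps_var) a =
    (\<Sum>j\<in>{0}. of_nat (k choose j) * (beta / 2) ^ j * mps_nth (psum (k - j) mps_var) a)"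
    unfolding psum_square_def mps_nth_sum mps_nth_const_mult
  proof (rule sum.mono_neutral_right)
    show "\<forall>j\<in>{..<k} - {0}. of_nat (k choose j) * (beta / 2) ^ j * mps_nth (psum (k - j) mps_var) a = 0"
    proof
      fix j assume "j \<in> {..<k} - {0}"
      then have "k - j > 0" "a \<noteq> replicate_mset (k - j) i" for i using a k by auto
      then show "of_nat (k choose j) * (beta / 2) ^ j * mps_nth (psum (k - j) mps_var) a = 0"
        by (simp add: mps_nth_psum_var)
    qed
  qed (use k in auto)
  then show "mps_nth (psum_square k mps_var) a = mps_nth (psum k mps_var) a" by simp
qed

lemma zero_notin_OP: "\<mu> \<in> OP \<Longrightarrow> 0 \<notin># \<mu>"
  by (auto simp: OP_def)

section \<open>Dual families\<close>

text \<open>Uniqueness of the coordinates: in the difference of two expansions, possibly infinite, a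
  nonzero entry of least weight exists by well-ordering, and lowest components are
  independent.\<close>

lemma coords_round_p_round:
  assumes \<mu>: "\<mu> \<in> OP"
  shows "coords_round (p_round \<mu> mps_var) = (\<lambda>\<nu>. if \<nu> = \<mu> then 1 else 0)"
  unfolding coords_round_def
proof (rule the_equality, intro conjI allI impI)
  let ?d = "\<lambda>\<nu>. if \<nu> = \<mu> then 1 else 0 :: qbeta"
  show "?d \<nu> = 0" if "\<nu> \<notin> OP" for \<nu> using that \<mu> by auto
  show has: "((\<lambda>\<nu>. mps_const (?d \<nu>) * p_round \<nu> mps_var) has_sum p_round \<mu> mps_var) OP"
    by (rule has_sum_single[of _ \<mu>]) (use \<mu> in auto)
  fix c assume c: "(\<forall>\<nu>. \<nu> \<notin> OP \<longrightarrow> c \<nu> = 0) \<and>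
    ((\<lambda>\<nu>. mps_const (c \<nu>) * p_round \<nu> mps_var) has_sum p_round \<mu> mps_var) OP"
  have zero: "((\<lambda>\<nu>. mps_const (c \<nu> - ?d \<nu>) * (\<Prod>k\<in>#\<nu>. psum_round k mps_var)) has_sum 0) OP"
    using has_sum_mps_diff[OF conjunct2[OF c] has] by (simp add: left_diff_distrib p_round_def)
  show "c = ?d"
  proof (rule ccontr)
    assume "c \<noteq> ?d"
    then obtain \<kappa> where \<kappa>: "c \<kappa> \<noteq> ?d \<kappa>" by blast
    define Q where "Q \<nu> \<longleftrightarrow> \<nu> \<in> OP \<and> c \<nu> - ?d \<nu> \<noteq> 0" for \<nu>
    have "Q \<kappa>"
      unfolding Q_def using \<kappa> conjunct1[OF c, rule_format, of \<kappa>] \<mu> by (cases "\<kappa> \<in> OP") (auto split: if_splits)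
    from ex_has_least_nat[of Q, OF this, of sum_mset]
    obtain \<nu> where \<nu>: "Q \<nu>" and min: "\<forall>\<tau>. Q \<tau> \<longrightarrow> sum_mset \<nu> \<le> sum_mset \<tau>"
      by (elim exE conjE)
    show False
    proof (rule round.independent[OF zero_notin_OP zero])
      show "\<nu> \<in> OP" "c \<nu> - ?d \<nu> \<noteq> 0" using \<nu> by (simp_all add: Q_def)
      show "1 * int (sum_mset \<nu>) \<le> 1 * int (sum_mset \<tau>)" if "\<tau> \<in> OP" "c \<tau> - ?d \<tau> \<noteq> 0" for \<tau>
      proof -
        have "Q \<tau>" using that by (simp add: Q_def)
        then have "sum_mset \<nu> \<le> sum_mset \<tau>" using min by blast
        then have "int (sum_mset \<nu>) \<le> int (sum_mset \<tau>)" by (simp only: of_nat_le_iff)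
        then show ?thesis by linarith
      qed
    qed
  qed
qed

text \<open>Here the highest components are compared; finite support guarantees a nonzero entry of
  greatest weight. Finite combinations are recast as \<open>has_sum\<close> over \<open>OP\<close>
  so that the same independence lemma applies.\<close>

lemma coords_square_p_square:
  assumes \<mu>: "\<mu> \<in> OP"
  shows "coords_square (mps_const s * p_square \<mu> mps_var) = (\<lambda>\<nu>. if \<nu> = \<mu> then s else 0)"
  unfolding coords_square_def
proof (rule the_equality, intro conjI allI impI)
  let ?g = "mps_const s * p_square \<mu> mps_var :: series"
  let ?d = "\<lambda>\<nu>. if \<nu> = \<mu> then s else 0"
  show "?d \<nu> = 0" if "\<nu> \<notin> OP" for \<nu> using that \<mu> by auto
  have sub: "{\<nu>. ?d \<nu> \<noteq> 0} \<subseteq> {\<mu>}" by auto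
  then show "finite {\<nu>. ?d \<nu> \<noteq> 0}" by (rule finite_subset) simp
  have "(\<Sum>\<nu> | ?d \<nu> \<noteq> 0. mps_const (?d \<nu>) * p_square \<nu> mps_var) =
      (\<Sum>\<nu>\<in>{\<mu>}. mps_const (?d \<nu>) * p_square \<nu> mps_var :: series)"
    using sub by (intro sum.mono_neutral_left) auto
  then show "?g = (\<Sum>\<nu> | ?d \<nu> \<noteq> 0. mps_const (?d \<nu>) * p_square \<nu> mps_var)" by simp
  have has: "((\<lambda>\<nu>. mps_const (?d \<nu>) * p_square \<nu> mps_var) has_sum ?g) OP"
    by (rule has_sum_single[of _ \<mu>]) (use \<mu> in auto)
  fix c assume c: "(\<forall>\<nu>. \<nu> \<notin> OP \<longrightarrow> c \<nu> = 0) \<and> finite {\<nu>. c \<nu> \<noteq> 0} \<and>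
    ?g = (\<Sum>\<nu> | c \<nu> \<noteq> 0. mps_const (c \<nu>) * p_square \<nu> mps_var)"
  have fin: "finite {\<nu>. c \<nu> \<noteq> 0}" and g: "?g = (\<Sum>\<nu> | c \<nu> \<noteq> 0. mps_const (c \<nu>) * p_square \<nu> mps_var)"
    and off: "\<forall>\<nu>. \<nu> \<notin> OP \<longrightarrow> c \<nu> = 0" using c by simp_all
  have "((\<lambda>\<nu>. mps_const (c \<nu>) * p_square \<nu> mps_var) has_sum ?g) {\<nu>. c \<nu> \<noteq> 0}"
    using fin g by (rule has_sum_finiteI)
  then have "((\<lambda>\<nu>. mps_const (c \<nu>) * p_square \<nu> mps_var) has_sum ?g) OP"
    using off by (subst has_sum_cong_neutral[where T = "{\<nu>. c \<nu> \<noteq> 0}"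
      and g = "\<lambda>\<nu>. mps_const (c \<nu>) * p_square \<nu> mps_var"]) auto
  from has_sum_mps_diff[OF this has]
  have zero: "((\<lambda>\<nu>. mps_const (c \<nu> - ?d \<nu>) * (\<Prod>k\<in>#\<nu>. psum_square k mps_var)) has_sum 0) OP"
    by (simp add: left_diff_distrib p_square_def)
  show "c = ?d"
  proof (rule ccontr)
    assume "c \<noteq> ?d"
    then obtain \<kappa> where \<kappa>: "c \<kappa> \<noteq> ?d \<kappa>" by blast
    define Q where "Q \<nu> \<longleftrightarrow> \<nu> \<in> OP \<and> c \<nu> - ?d \<nu> \<noteq> 0" for \<nu>
    have "Q \<kappa>"
      unfolding Q_def using \<kappa> off[rule_format, of \<kappa>] \<mu> by (cases "\<kappa> \<in> OP") (auto split: if_splits)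
    \<comment> \<open>The difference may be nonzero at \<open>\<mu>\<close> although
      \<open>c \<mu> = 0\<close>, so \<open>\<mu>\<close> must be included in the bound.\<close>
    let ?S = "sum_mset ` insert \<mu> {\<nu>. c \<nu> \<noteq> 0}"
    have bound: "\<forall>\<nu>. Q \<nu> \<longrightarrow> sum_mset \<nu> < Suc (Max ?S)"
    proof (intro allI impI)
      fix \<nu> assume "Q \<nu>"
      then have "\<nu> \<in> insert \<mu> {\<nu>. c \<nu> \<noteq> 0}" by (simp add: Q_def split: if_splits)
      then have "sum_mset \<nu> \<le> Max ?S" using fin by (intro Max_ge) auto
      then show "sum_mset \<nu> < Suc (Max ?S)" by simp
    qed
    from ex_has_greatest_nat[of Q, OF \<open>Q \<kappa>\<close> bound]
    obtain \<nu> where \<nu>: "Q \<nu>" and max: "\<forall>\<tau>. Q \<tau> \<longrightarrow> sum_mset \<tau> \<le> sum_mset \<nu>"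
      by (elim exE conjE)
    show False
    proof (rule square.independent[OF zero_notin_OP zero])
      show "\<nu> \<in> OP" "c \<nu> - ?d \<nu> \<noteq> 0" using \<nu> by (simp_all add: Q_def)
      show "- 1 * int (sum_mset \<nu>) \<le> - 1 * int (sum_mset \<tau>)" if "\<tau> \<in> OP" "c \<tau> - ?d \<tau> \<noteq> 0" for \<tau>
      proof -
        have "Q \<tau>" using that by (simp add: Q_def)
        then have "sum_mset \<tau> \<le> sum_mset \<nu>" using max by blast
        then have "int (sum_mset \<tau>) \<le> int (sum_mset \<nu>)" by (simp only: of_nat_le_iff)
        then show ?thesis by linarith
      qed
    qed
  qed
qed

lemma dual_families_p_round_p_square:
  "dual_families OP (\<lambda>\<mu>. p_round \<mu> mps_var)
    (\<lambda>\<mu>. mps_const (2 ^ size \<mu> / of_nat (z_part \<mu>)) * p_square \<mu> mps_var)"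
proof -
  have "pairing (p_round \<mu> mps_var) (mps_const (2 ^ size \<nu> / of_nat (z_part \<nu>)) * p_square \<nu> mps_var) =
      (if \<mu> = \<nu> then 1 else 0)" if "\<mu> \<in> OP" "\<nu> \<in> OP" for \<mu> \<nu>
  proof -
    let ?s = "2 ^ size \<nu> / of_nat (z_part \<nu>) :: qbeta"
    have s: "?s \<noteq> 0" "?s * (of_nat (z_part \<nu>) / 2 ^ size \<nu>) = 1"
      using z_part_nonzero[OF that(2)] by simp_all
    have "{\<kappa>. (if \<kappa> = \<nu> then ?s else 0) \<noteq> 0} = {\<nu>}" using s(1) by auto
    then show ?thesis
      unfolding pairing_def coords_round_p_round[OF that(1)] coords_square_p_square[OF that(2)]
      using s(2) z_part_nonzero[OF that(2)] by simp
  qed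
  then show ?thesis
    by (simp add: dual_families_def p_round_in_GGamma const_mult_p_square_in_gGamma)
qed

theorem theorem3p5:
  shows "\<exists>K.
    ((\<lambda>\<mu>. mps_const (2 ^ size \<mu> / of_nat (z_part \<mu>)) * p_round \<mu> xv * p_square \<mu> yv) has_sum K) OP \<and>
    has_uprod (\<lambda>(i, j). (1 - bar (xv i) * yv j) / (1 - xv i * yv j)) K (UNIV :: (nat \<times> nat) set) \<and>
    is_Cauchy_kernel OP
      (\<lambda>\<mu>. p_round \<mu> mps_var)
      (\<lambda>\<mu>. mps_const (2 ^ size \<mu> / of_nat (z_part \<mu>)) * p_square \<mu> mps_var)
      K"
proof (intro exI[of _ "odd_exp kernel_psum"] conjI)
  \<comment> \<open>The witness is the exponential at the products of the two deformed power sums: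
    the sum by its definition, the infinite product by its multiplicativity.\<close>
  show "((\<lambda>\<mu>. mps_const (2 ^ size \<mu> / of_nat (z_part \<mu>)) * p_round \<mu> xv * p_square \<mu> yv)
      has_sum odd_exp kernel_psum) OP"
    by (rule kernel_has_sum)
  show "has_uprod (\<lambda>(i, j). (1 - bar (xv i) * yv j) / (1 - xv i * yv j)) (odd_exp kernel_psum) UNIV"
    by (rule has_uprod_kernel)
  have y: "mps_subst yv (mps_const s * p_square \<mu> mps_var) = mps_const s * p_square \<mu> yv" for s \<mu>
    using null_family_yv unfolding null_family_def
    by (intro has_subst_imp_eq has_subst_mult has_subst_const has_subst_p_square) simp
  have "((\<lambda>\<mu>. mps_subst xv (p_round \<mu> mps_var) *
      mps_subst yv (mps_const (2 ^ size \<mu> / of_nat (z_part \<mu>)) * p_square \<mu> mps_var))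
      has_sum odd_exp kernel_psum) OP"
    using kernel_has_sum
    by (rule has_sum_cong[THEN iffD1, rotated])
      (simp only: mps_subst_p_round[OF null_family_xv] y, simp only: mult_ac)
  then show "is_Cauchy_kernel OP (\<lambda>\<mu>. p_round \<mu> mps_var)
      (\<lambda>\<mu>. mps_const (2 ^ size \<mu> / of_nat (z_part \<mu>)) * p_square \<mu> mps_var) (odd_exp kernel_psum)"
    by (simp add: is_Cauchy_kernel_def dual_families_p_round_p_square)
qed

end
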